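(* Let $H_{125}$ be the Heisenberg group of upper-unitriangular $3\times 3$ matrices over $\mathbb{F}_5$. Then $\mathsf{d}(H_{125})=12$. Equivalently, the sequence $x^4y^4v^4$ (four copies each of $x$, $y$ and $v$, of length $12$) is a product-one-free sequence of maximal length over $H_{125}$.
   Context: For $a,b,c\in\mathbb{F}_5$ write $M(a,b,c)=\begin{pmatrix}1&a&c\\0&1&b\\0&0&1\end{pmatrix}$; $H_{125}$ is the group of all such matrices, with $M(a,b,c)M(a',b',c')=M(a+a',b+b',c+c'+ab')$ and identity $M(0,0,0)$. It has order $125$ and exponent $5$. Put $x=M(1,0,0)$, $y=M(0,1,0)$, $v=M(0,0,1)$. A sequence over a finite group $G$ is a finite unordered list of elements of $G$, with repetition allowed and the identity excluded (i.e. a finite multiset of non-identity elements). A sequence $S$ is product-one-free if no nonempty subsequence (sub-multiset) of $S$ admits an ordering of its terms whose product is the identity. The small Davenport constant $\mathsf{d}(G)$ is the maximal length (number of terms counted with multiplicity) of a product-one-free sequence over $G$. *)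

theory Defs
  imports "HOL-Analysis.Analysis" "HOL-Algebra.Coset" "HOL-Library.Multiset"
begin

text \<open>
  The field with five elements is the numeral type \<^typ>\<open>5\<close>, whose ring operations are
  arithmetic modulo 5.
\<close>

definition heis_mat :: "5 \<Rightarrow> 5 \<Rightarrow> 5 \<Rightarrow> 5 ^ 3 ^ 3" where
  "heis_mat a b c = vector [vector [1, a, c], vector [0, 1, b], vector [0, 0, 1]]"

definition H125 :: "(5 ^ 3 ^ 3) monoid" where
  "H125 = \<lparr>carrier = {heis_mat a b c | a b c. True}, mult = (**), one = mat 1\<rparr>"

definition sequence_over :: "('a, 'b) monoid_scheme \<Rightarrow> 'a multiset \<Rightarrow> bool" where
  "sequence_over G S \<longleftrightarrow> set_mset S \<subseteq> carrier G - {\<one>\<^bsub>G\<^esub>}"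

definition product_one_free :: "('a, 'b) monoid_scheme \<Rightarrow> 'a multiset \<Rightarrow> bool" where
  "product_one_free G S \<longleftrightarrow>
     (\<forall>T. T \<subseteq># S \<and> T \<noteq> {#} \<longrightarrow> \<not> (\<exists>xs. mset xs = T \<and> foldr (\<otimes>\<^bsub>G\<^esub>) xs \<one>\<^bsub>G\<^esub> = \<one>\<^bsub>G\<^esub>))"

text \<open>
  The maximum below is taken over a nonempty finite set whenever \<open>G\<close> is a finite group, see
  \<open>finite_product_one_free_sizes\<close>; it is unspecified if the lengths are unbounded.
\<close>

definition small_davenport :: "('a, 'b) monoid_scheme \<Rightarrow> nat" where
  "small_davenport G = Max {size S | S. sequence_over G S \<and> product_one_free G S}"

lemma heis_mat_eq_iff:
  "heis_mat a b c = heis_mat a' b' c' \<longleftrightarrow> a = a' \<and> b = b' \<and> c = c'"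
  by (auto simp: heis_mat_def vec_eq_iff forall_3)

lemma heis_mat_mult:
  "heis_mat a b c ** heis_mat a' b' c' = heis_mat (a + a') (b + b') (c + c' + a * b')"
  by (simp add: heis_mat_def matrix_matrix_mult_def vec_eq_iff forall_3 sum_3 algebra_simps)

lemma mat_1_eq_heis_mat: "mat 1 = heis_mat 0 0 0"
  by (simp add: heis_mat_def mat_def vec_eq_iff forall_3)

lemma group_H125: "group H125"
proof (rule groupI)
  fix x assume "x \<in> carrier H125"
  then obtain a b c where "x = heis_mat a b c" by (auto simp: H125_def)
  then have "heis_mat (- a) (- b) (a * b - c) \<otimes>\<^bsub>H125\<^esub> x = \<one>\<^bsub>H125\<^esub>"
    by (simp add: H125_def heis_mat_mult mat_1_eq_heis_mat heis_mat_eq_iff)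
  then show "\<exists>y\<in>carrier H125. y \<otimes>\<^bsub>H125\<^esub> x = \<one>\<^bsub>H125\<^esub>"
    by (auto simp: H125_def)
qed (auto simp: H125_def heis_mat_mult mat_1_eq_heis_mat heis_mat_eq_iff algebra_simps)

lemma order_H125: "order H125 = 125"
proof -
  have "carrier H125 = (\<lambda>(a, b, c). heis_mat a b c) ` UNIV"
    by (auto simp: H125_def image_iff heis_mat_eq_iff)
  moreover have "inj (\<lambda>(a, b, c). heis_mat a b c)"
    by (auto simp: inj_def heis_mat_eq_iff)
  ultimately have "order H125 = CARD(5 \<times> 5 \<times> 5)"
    by (simp add: order_def card_image)
  then show ?thesis by simp
qed

lemma (in group) product_one_free_size_less:
  assumes fin: "finite (carrier G)" and seq: "sequence_over G S" and free: "product_one_free G S"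
  shows "size S < order G"
proof (rule ccontr)
  assume "\<not> size S < order G"
  obtain xs where xs: "mset xs = S" using ex_mset by blast
  have car: "set xs \<subseteq> carrier G" using seq xs by (auto simp: sequence_over_def)
  define p where "p zs = foldr (\<otimes>) zs \<one>" for zs
  have p_closed: "p zs \<in> carrier G" if "set zs \<subseteq> carrier G" for zs
    using that by (induction zs) (auto simp: p_def)
  have p_append: "p (zs @ ws) = p zs \<otimes> p ws"
    if "set zs \<subseteq> carrier G" "set ws \<subseteq> carrier G" for zs ws
    using that(1)
  proof (induction zs)
    case Nil
    then show ?case using p_closed[OF that(2)] by (simp add: p_def)
  next
    case (Cons z zs)
    then have "p (zs @ ws) = p zs \<otimes> p ws" and "z \<in> carrier G" and "p zs \<in> carrier G"
      using p_closed[of zs] by simp_all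
    then show ?case using p_closed[OF that(2)] by (simp add: p_def m_assoc)
  qed
  have take_closed: "p (take i xs) \<in> carrier G" for i
    by (rule p_closed[OF subset_trans[OF set_take_subset car]])
  have "\<not> inj_on (\<lambda>i. p (take i xs)) {0..size S}"
  proof (rule pigeonhole)
    have "card ((\<lambda>i. p (take i xs)) ` {0..size S}) \<le> order G"
      unfolding order_def using fin take_closed by (intro card_mono) auto
    then show "card ((\<lambda>i. p (take i xs)) ` {0..size S}) < card {0..size S}"
      using \<open>\<not> size S < order G\<close> by simp
  qed
  then obtain i j where ij: "i < j" "j \<le> size S" "p (take i xs) = p (take j xs)"
    unfolding inj_on_def by (metis atLeastAtMost_iff linorder_neqE_nat)
  define ws where "ws = take (j - i) (drop i xs)"
  have take_j: "take j xs = take i xs @ ws"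
    using ij(1) by (metis ws_def le_add_diff_inverse less_imp_le take_add)
  have ws_car: "set ws \<subseteq> carrier G"
    unfolding ws_def using car by (meson set_drop_subset set_take_subset subset_trans)
  have "p (take i xs) \<otimes> p ws = p (take i xs)"
    using p_append[OF subset_trans[OF set_take_subset car] ws_car] ij(3) take_j by simp
  then have "p ws = \<one>"
    using l_cancel_one[OF take_closed p_closed[OF ws_car]] by blast
  moreover have "ws \<noteq> []"
    using ij xs by (auto simp: ws_def)
  moreover have "mset ws \<subseteq># S"
  proof -
    have "xs = take i xs @ ws @ drop j xs"
      by (metis take_j append_assoc append_take_drop_id)
    then have "S = mset (take i xs) + (mset ws + mset (drop j xs))"
      using xs by (metis mset_append)
    then show ?thesis by simp
  qed
  ultimately show False using free by (auto simp: product_one_free_def p_def)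
qed

lemma (in group) finite_product_one_free_sizes:
  assumes "finite (carrier G)"
  shows "finite {size S | S. sequence_over G S \<and> product_one_free G S}"
    and "{size S | S. sequence_over G S \<and> product_one_free G S} \<noteq> {}"
proof -
  show "finite {size S | S. sequence_over G S \<and> product_one_free G S}"
    by (rule finite_subset[of _ "{..<order G}"]) (auto simp: product_one_free_size_less assms)
  have "sequence_over G {#} \<and> product_one_free G {#}"
    by (simp add: sequence_over_def product_one_free_def)
  then show "{size S | S. sequence_over G S \<and> product_one_free G S} \<noteq> {}" by blast
qed

end

theory Submission
  imports Defs
begin

text \<open>
  In exponential coordinates an element of the group is a pair of a vector \<open>u\<close> in the plane over
  the field with five elements and a scalar \<open>h\<close>, and the product of a sequence is the sum of its
  terms, except that half the \<^emph>\<open>area\<close> of the sequence is added to the scalar, where the area is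
  the sum of the determinants \<open>det2 u\<^sub>i u\<^sub>j\<close> over \<open>i < j\<close>. A product-one subsequence is therefore
  one whose vectors have sum 0 and for which some order has the right area. It suffices to
  find a zero-sum sequence of vectors that has many areas: its products are central elements,
  and if all five areas occur, then the identity is among them. If \<open>k\<close> nontrivial central
  elements are available as further factors, then \<open>5 - k\<close> areas are enough.

  Given thirteen elements, \<open>k\<close> of them central, the other \<open>13 - k\<close> have nonzero vectors. The
  Davenport constant of the plane is 9, so they have a zero-sum subsequence of length at least
  \<open>5 - k\<close>. A zero-sum sequence of nonzero vectors that spans the plane has at least as many
  areas as its length minus 1, up to the maximum 5 (\<open>card_areas_zero_sum\<close>); so a spanning
  zero-sum sequence of length at least \<open>6 - k\<close> is enough. The theorem \<open>zero_sum_with_many_areas\<close>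
  treats what remains. If many vectors lie on a line, or if the longest zero-sum subsequence
  does, then the vectors off the line, taken modulo the line, and those on it combine to a
  long spanning zero-sum sequence (\<open>long_spanning_zero_sum\<close>), unless there are so many over the
  line that the abelian subgroup over it already has a product-one subsequence
  (\<open>has_product_one_line\<close>). If the longest zero-sum subsequence has length exactly \<open>5 - k\<close>, then
  its complement is a zero-sum free sequence of the maximal length 8, and these are so rigid
  that exchanging terms with the complement leads to a longer zero-sum subsequence, or to one
  inside the complement (\<open>max_zero_sum_not_one_repetition\<close>), except in a case where all five
  areas occur.

  For the lower bound, a product of letters \<open>x\<close>, \<open>y\<close> and \<open>v\<close>, each used at most four times, is the
  identity only if no \<open>x\<close> and no \<open>y\<close> occurs, and then no \<open>v\<close>.
\<close>

section \<open>The field with five elements\<close>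

lemma F5_all: "(\<forall>x::5. P x) \<longleftrightarrow> P 0 \<and> P 1 \<and> P 2 \<and> P 3 \<and> P 4"
proof -
  have "x \<in> {0, 1, 2, 3, 4}" for x :: 5
  proof -
    obtain z where z: "x = of_int z" "0 \<le> z" "z < 5"
      by (cases x) auto
    then have "z \<in> {0, 1, 2, 3, 4}" by auto
    with z(1) show ?thesis by auto
  qed
  then show ?thesis by (metis empty_iff insert_iff)
qed

lemma F5_mult_eq_0: "x * y = 0 \<longleftrightarrow> x = 0 \<or> y = 0" for x y :: 5
proof -
  have "\<forall>x y :: 5. x * y = 0 \<longleftrightarrow> x = 0 \<or> y = 0" unfolding F5_all by simp
  then show ?thesis by blast
qed

lemma F5_power_4: "x \<noteq> 0 \<Longrightarrow> x ^ 4 = 1" for x :: 5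
proof -
  have "\<forall>x::5. x \<noteq> 0 \<longrightarrow> x ^ 4 = 1" unfolding F5_all by simp
  then show "x \<noteq> 0 \<Longrightarrow> x ^ 4 = 1" by blast
qed

section \<open>Zero-sum subsequences\<close>

definition zero_sum_free :: "'a::comm_monoid_add multiset \<Rightarrow> bool" where
  "zero_sum_free M \<longleftrightarrow> (\<forall>T. T \<subseteq># M \<and> T \<noteq> {#} \<longrightarrow> sum_mset T \<noteq> 0)"

text \<open>
  Maximality refers to the length, not to inclusion; the exchange arguments below depend on
  this.
\<close>

definition max_zero_sum :: "'a::comm_monoid_add multiset \<Rightarrow> 'a multiset \<Rightarrow> bool" where
  "max_zero_sum U T \<longleftrightarrow> T \<subseteq># U \<and> sum_mset T = 0 \<and>
     (\<forall>T'. T' \<subseteq># U \<and> sum_mset T' = 0 \<longrightarrow> size T' \<le> size T)"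

definition subsums :: "'a::comm_monoid_add multiset \<Rightarrow> 'a set" where
  "subsums M = {sum_mset T | T. T \<subseteq># M}"

lemma zero_sum_freeD: "zero_sum_free M \<Longrightarrow> T \<subseteq># M \<Longrightarrow> sum_mset T = 0 \<Longrightarrow> T = {#}"
  unfolding zero_sum_free_def by blast

lemma zero_sum_free_nonzero: "zero_sum_free M \<Longrightarrow> 0 \<notin># M"
  using zero_sum_freeD[of M "{#0#}"] by auto

lemma subsumsI: "T \<subseteq># M \<Longrightarrow> sum_mset T \<in> subsums M"
  unfolding subsums_def by blast

lemma subsumsE:
  assumes "s \<in> subsums M" obtains T where "T \<subseteq># M" "sum_mset T = s"
  using assms unfolding subsums_def by blast

lemma subseteq_add_mset_notin: "T \<subseteq># add_mset x M \<Longrightarrow> x \<notin># T \<Longrightarrow> T \<subseteq># M"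
proof -
  assume *: "T \<subseteq># add_mset x M" "x \<notin># T"
  have "count T y \<le> count M y" for y
    using mset_subset_eq_count[OF *(1), of y] *(2)
    by (cases "y = x") (auto simp: count_eq_zero_iff[symmetric])
  then show "T \<subseteq># M" by (simp add: subseteq_mset_def)
qed

lemma subseteq_image_mset:
  "T \<subseteq># image_mset f M \<Longrightarrow> \<exists>J. J \<subseteq># M \<and> image_mset f J = T"
proof (induction M arbitrary: T)
  case (add x M)
  show ?case
  proof (cases "f x \<in># T")
    case True
    then obtain T' where T: "T = add_mset (f x) T'" by (meson multi_member_split)
    then obtain J where "J \<subseteq># M" "image_mset f J = T'" using add by auto
    then show ?thesis using T by (intro exI[of _ "add_mset x J"]) simp
  next
    case False
    then have "T \<subseteq># image_mset f M"
      using add.prems subseteq_add_mset_notin by simp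
    then obtain J where "J \<subseteq># M" "image_mset f J = T" using add.IH by blast
    then show ?thesis
      by (intro exI[of _ J]) (auto intro: subset_mset.order_trans)
  qed
qed auto

lemma ex_max_zero_sum: "\<exists>T. max_zero_sum U T"
proof -
  let ?P = "\<lambda>T. T \<subseteq># U \<and> sum_mset T = 0"
  have "?P {#}" by simp
  moreover have "\<forall>T. ?P T \<longrightarrow> size T < Suc (size U)" by (simp add: less_Suc_eq_le size_mset_mono)
  ultimately obtain T where "?P T" "\<forall>T'. ?P T' \<longrightarrow> size T' \<le> size T"
    using ex_has_greatest_nat[of ?P "{#}" size "Suc (size U)"] by metis
  then have "max_zero_sum U T" by (simp add: max_zero_sum_def)
  then show ?thesis ..
qed

lemma sum_mset_diff: "T \<subseteq># U \<Longrightarrow> sum_mset (U - T) = sum_mset U - sum_mset T"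
  for T :: "'a::ab_group_add multiset"
  using sum_mset.union[of "U - T" T] by (simp add: eq_diff_eq)

lemma mset_double_diff: "X \<subseteq># T \<Longrightarrow> T - (T - X) = X"
  by (rule multiset_eqI) (auto simp: subseteq_mset_def)

lemma max_zero_sum_complement:
  assumes "max_zero_sum U T" shows "zero_sum_free (U - T)"
  unfolding zero_sum_free_def
proof (intro allI impI notI)
  fix R assume R: "R \<subseteq># U - T \<and> R \<noteq> {#}" "sum_mset R = 0"
  have "T \<subseteq># U" using assms by (simp add: max_zero_sum_def)
  then have "T + R \<subseteq># U"
    using R(1) subset_mset.add_mono[of T T R "U - T"] by simp
  moreover have "sum_mset (T + R) = 0" using assms R by (simp add: max_zero_sum_def)
  ultimately have "size (T + R) \<le> size T" using assms unfolding max_zero_sum_def by blast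
  then show False using R by simp
qed

text \<open>
  This is the form in which Davenport constants enter. If every sequence of length \<open>d\<close> has a
  zero-sum subsequence and \<open>R\<close> is zero-sum free of length \<open>d - 1\<close>, then appending \<open>- g\<close> to \<open>R\<close> creates
  a zero-sum subsequence, which must use the new term.
\<close>

lemma subsums_zero_sum_free:
  fixes R :: "'a::ab_group_add multiset"
  assumes dav: "\<And>M :: 'a multiset. d \<le> size M \<Longrightarrow> \<not> zero_sum_free M"
    and R: "zero_sum_free R" "d \<le> Suc (size R)"
  shows "\<exists>A. A \<subseteq># R \<and> sum_mset A = g"
proof -
  have "\<not> zero_sum_free (add_mset (- g) R)" using dav R(2) by simp
  then obtain T where T: "T \<subseteq># add_mset (- g) R" "T \<noteq> {#}" "sum_mset T = 0"
    unfolding zero_sum_free_def by blast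
  have "- g \<in># T"
  proof (rule ccontr)
    assume "- g \<notin># T"
    then have "T \<subseteq># R" using T(1) by (rule subseteq_add_mset_notin[rotated])
    then show False using R(1) T unfolding zero_sum_free_def by blast
  qed
  then obtain A where A: "T = add_mset (- g) A" by (meson multi_member_split)
  have "A \<subseteq># R" using T(1) A by simp
  moreover have "sum_mset A = g" using T(3) A by (simp add: eq_neg_iff_add_eq_0 add.commute)
  ultimately show ?thesis by blast
qed

lemma exchange:
  fixes U :: "'a::ab_group_add multiset"
  assumes T: "max_zero_sum U T" and X: "X \<subseteq># T" and A: "A \<subseteq># U - T"
    and sum: "sum_mset A = sum_mset (T - X)"
  shows "X + A \<subseteq># U" "sum_mset (X + A) = 0" "size (X + A) \<le> size T"
proof -
  have TU: "T \<subseteq># U" "sum_mset T = 0" using T by (auto simp: max_zero_sum_def)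
  have "X + A \<subseteq># T + (U - T)" using X A by (rule subset_mset.add_mono)
  then show *: "X + A \<subseteq># U" using TU by simp
  show **: "sum_mset (X + A) = 0" using X sum TU by (simp add: sum_mset_diff)
  show "size (X + A) \<le> size T" using T * ** unfolding max_zero_sum_def by blast
qed

text \<open>
  If the complement of a longest zero-sum subsequence \<open>T\<close> is as long as a zero-sum free sequence
  can be, then \<open>t\<close> is a subsequence sum of the complement. Replacing \<open>t\<close> by such a subsequence
  gives another zero-sum subsequence, so the replacement can have only one term.
\<close>

lemma exchange_single:
  fixes U :: "'a::ab_group_add multiset"
  assumes dav: "\<And>M :: 'a multiset. d \<le> size M \<Longrightarrow> \<not> zero_sum_free M"
    and U: "0 \<notin># U" and T: "max_zero_sum U T" "d \<le> Suc (size (U - T))"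
    and t: "t \<in># T"
  shows "t \<in># U - T"
proof -
  obtain A where A: "A \<subseteq># U - T" "sum_mset A = t"
    using subsums_zero_sum_free[OF dav max_zero_sum_complement[OF T(1)] T(2)] by blast
  have "t \<in># U" using t T(1) by (auto simp: max_zero_sum_def dest: mset_subset_eqD)
  then have "A \<noteq> {#}" using A U by auto
  have "T - (T - {#t#}) = {#t#}" using t by (intro mset_double_diff) simp
  then have "size (T - {#t#} + A) \<le> size T"
    using exchange(3)[OF T(1), of "T - {#t#}" A] A by simp
  then have "size A \<le> 1" using t by (simp add: size_Diff_singleton)
  then have "size A = 1" using \<open>A \<noteq> {#}\<close> by (metis le_SucE One_nat_def le_zero_eq size_eq_0_iff_empty)
  then obtain a where "A = {#a#}" by (metis size_1_singleton_mset)
  then show ?thesis using A by simp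
qed

lemma count_exchange_single:
  fixes U :: "'a::ab_group_add multiset"
  assumes "\<And>M :: 'a multiset. d \<le> size M \<Longrightarrow> \<not> zero_sum_free M"
    and "0 \<notin># U" and "max_zero_sum U T" "d \<le> Suc (size (U - T))" and "t \<in># T"
  shows "count T t < count U t"
  using exchange_single[OF assms] by (simp flip: count_greater_zero_iff)

section \<open>The Davenport constant of the elementary abelian group of order 25\<close>

text \<open>
  The finite-difference form of the polynomial method: applying \<open>fdiff\<close> for all terms of a
  sequence to a function \<open>f\<close> evaluates, at 0, the alternating sum of \<open>f\<close> over all subsequence
  sums.
\<close>

definition fdiff :: "'a::ab_group_add \<Rightarrow> ('a \<Rightarrow> 'b::ab_group_add) \<Rightarrow> 'a \<Rightarrow> 'b" where
  "fdiff g f = (\<lambda>v. f v - f (v + g))"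

text \<open>
  The condition of being a polynomial function of degree less than \<open>d\<close>, expressed without
  coordinates: all \<open>d\<close>-fold differences vanish.
\<close>

fun deg_less :: "nat \<Rightarrow> ('a::ab_group_add \<Rightarrow> 'b::comm_ring_1) \<Rightarrow> bool" where
  "deg_less 0 f \<longleftrightarrow> f = (\<lambda>_. 0)"
| "deg_less (Suc d) f \<longleftrightarrow> (\<forall>g. deg_less d (fdiff g f))"

lemma deg_less_zero: "deg_less d (\<lambda>_. 0)"
  by (induction d) (auto simp: fdiff_def)

lemma deg_less_mono: "deg_less d f \<Longrightarrow> d \<le> e \<Longrightarrow> deg_less e f"
proof (induction d arbitrary: e f)
  case 0
  then show ?case by (simp add: deg_less_zero)
next
  case (Suc d)
  then show ?case by (cases e) auto
qed

lemma deg_less_add: "deg_less d f \<Longrightarrow> deg_less d f' \<Longrightarrow> deg_less d (\<lambda>v. f v + f' v)"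
proof (induction d arbitrary: f f')
  case (Suc d)
  have "fdiff g (\<lambda>v. f v + f' v) = (\<lambda>v. fdiff g f v + fdiff g f' v)" for g
    by (auto simp: fdiff_def)
  then show ?case using Suc by simp
qed auto

lemma deg_less_shift: "deg_less d f \<Longrightarrow> deg_less d (\<lambda>v. f (v + h))"
proof (induction d arbitrary: f)
  case (Suc d)
  have "fdiff g (\<lambda>v. f (v + h)) = (\<lambda>v. fdiff g f (v + h))" for g
    by (auto simp: fdiff_def algebra_simps)
  then show ?case using Suc by simp
qed auto

text \<open>
  The product rule \<open>fdiff g (f f') = fdiff g f \<cdot> f' + f(_ + g) \<cdot> fdiff g f'\<close> lowers the degree of
  one factor in each summand.
\<close>

lemma deg_less_mult:
  "deg_less (Suc d) f \<Longrightarrow> deg_less (Suc e) f' \<Longrightarrow> deg_less (Suc (d + e)) (\<lambda>v. f v * f' v)"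
proof (induction "d + e" arbitrary: d e f f' rule: less_induct)
  case less
  have *: "fdiff g (\<lambda>v. f v * f' v) = (\<lambda>v. fdiff g f v * f' v + f (v + g) * fdiff g f' v)" for g
    by (auto simp: fdiff_def algebra_simps)
  have "deg_less (d + e) (\<lambda>v. fdiff g f v * f' v)" for g
  proof (cases d)
    case 0
    then have "fdiff g f = (\<lambda>_. 0)" using less.prems by simp
    then show ?thesis by (simp add: deg_less_zero)
  next
    case (Suc d')
    then show ?thesis using less.hyps[of d' e "fdiff g f" f'] less.prems by simp
  qed
  moreover have "deg_less (d + e) (\<lambda>v. f (v + g) * fdiff g f' v)" for g
  proof (cases e)
    case 0
    then have "fdiff g f' = (\<lambda>_. 0)" using less.prems by simp
    then show ?thesis by (simp add: deg_less_zero)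
  next
    case (Suc e')
    then show ?thesis
      using less.hyps[of d e' "\<lambda>v. f (v + g)" "fdiff g f'"] less.prems deg_less_shift[of "Suc d" f g]
      by simp
  qed
  ultimately show ?case unfolding deg_less.simps * by (intro allI deg_less_add)
qed

lemma deg_less_const: "deg_less (Suc 0) (\<lambda>_. c)"
  by (simp add: fdiff_def)

lemma deg_less_power: "deg_less (Suc d) f \<Longrightarrow> deg_less (Suc (d * n)) (\<lambda>v. f v ^ n)"
proof (induction n)
  case 0
  show ?case using deg_less_const[of "1"] by simp
next
  case (Suc n)
  then show ?case using deg_less_mult[of d f "d * n" "\<lambda>v. f v ^ n"] by simp
qed

lemma deg_less_uminus: "deg_less (Suc d) f \<Longrightarrow> deg_less (Suc d) (\<lambda>v. - f v)"
  using deg_less_mult[of 0 "\<lambda>_. -1" d f] deg_less_const[of "-1"] by simp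

lemma foldr_fdiff_deg_less: "deg_less (length xs) f \<Longrightarrow> foldr fdiff xs f = (\<lambda>_. 0)"
proof (induction xs arbitrary: f rule: rev_induct)
  case (snoc x xs)
  then show ?case by simp
qed auto

lemma foldr_fdiff_sparse:
  assumes "\<And>T. T \<subseteq># mset xs \<Longrightarrow> T \<noteq> {#} \<Longrightarrow> f (v + sum_mset T) = 0"
  shows "foldr fdiff xs f v = f v"
  using assms
proof (induction xs arbitrary: v)
  case (Cons x xs)
  have 1: "foldr fdiff xs f v = f v"
    using Cons.prems
    by (intro Cons.IH)
      (metis mset.simps(2) subset_mset.dual_order.trans multi_psub_of_add_self
        subset_mset.less_imp_le)
  have 2: "f (v + x + sum_mset T) = 0" if "T \<subseteq># mset xs" for T
    using Cons.prems[of "add_mset x T"] that by (simp add: add.assoc)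
  have "foldr fdiff xs f (v + x) = f (v + x)"
    using 2 by (intro Cons.IH) blast
  also have "\<dots> = 0" using 2[of "{#}"] by simp
  finally show ?case using 1 by (simp add: fdiff_def[of x])
qed simp

text \<open>
  Olson's theorem for the group of order 25. The indicator function of 0 on the plane is
  \<open>(1 - a^4) (1 - b^4)\<close>, of degree 8, so nine differences annihilate it. On a zero-sum free
  sequence the alternating sum would keep only the empty subsequence and equal 1.
\<close>

theorem not_zero_sum_free_F5_plane:
  fixes M :: "(5 \<times> 5) multiset"
  assumes "9 \<le> size M"
  shows "\<not> zero_sum_free M"
proof
  assume free: "zero_sum_free M"
  obtain xs where xs: "mset xs = M" using ex_mset by blast
  define f :: "5 \<times> 5 \<Rightarrow> 5" where "f v = (1 + - (fst v ^ 4)) * (1 + - (snd v ^ 4))" for v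
  have lin: "deg_less (Suc 1) (fst :: 5 \<times> 5 \<Rightarrow> 5)" "deg_less (Suc 1) (snd :: 5 \<times> 5 \<Rightarrow> 5)"
    by (auto simp: fdiff_def)
  have quart: "deg_less (Suc 4) (\<lambda>v. 1 + - (l v ^ 4))" if "deg_less (Suc 1) l"
    for l :: "5 \<times> 5 \<Rightarrow> 5"
  proof -
    have "deg_less (Suc 4) (\<lambda>v. l v ^ 4)"
      using deg_less_power[OF that, of 4] unfolding mult_1 .
    then show ?thesis
      by (intro deg_less_add deg_less_uminus deg_less_mono[OF deg_less_const]) simp_all
  qed
  have "deg_less (Suc (4 + 4)) f"
    unfolding f_def by (rule deg_less_mult[OF quart[OF lin(1)] quart[OF lin(2)]])
  moreover have "Suc (4 + 4) \<le> length xs" using assms xs by auto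
  ultimately have "deg_less (length xs) f" by (rule deg_less_mono)
  then have "foldr fdiff xs f 0 = 0" by (simp add: foldr_fdiff_deg_less)
  moreover have "f v = (if v = 0 then 1 else 0)" for v
    by (cases v) (auto simp: f_def F5_power_4 zero_prod_def)
  then have "foldr fdiff xs f 0 = f 0"
    using free xs unfolding zero_sum_free_def by (intro foldr_fdiff_sparse) simp
  ultimately show False by (simp add: f_def)
qed

section \<open>Subsequence sums modulo 5\<close>

lemma F5_of_nat_mod: "of_nat (n mod 5) = (of_nat n :: 5)"
proof -
  have "(of_nat (5 * (n div 5) + n mod 5) :: 5) = of_nat (n mod 5)"
    unfolding of_nat_add of_nat_mult by (simp add: F5_mult_eq_0)
  then show ?thesis by simp
qed

lemma F5_of_nat_surj: "\<exists>n. x = of_nat n" for x :: 5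
proof -
  have "of_nat 0 = (0::5)" "of_nat 1 = (1::5)" "of_nat 2 = (2::5)" "of_nat 3 = (3::5)"
    "of_nat 4 = (4::5)" by simp_all
  then have "\<forall>x::5. \<exists>n. x = of_nat n" unfolding F5_all by metis
  then show ?thesis by blast
qed

lemma F5_set_eq_UNIV: "5 \<le> card A \<Longrightarrow> A = UNIV" for A :: "5 set"
  using card_seteq[of UNIV A] by simp

text \<open>
  The one case of the Cauchy-Davenport inequality that is needed: a set that is closed under
  adding \<open>g \<noteq> 0\<close> is the whole field.
\<close>

lemma card_Un_shift:
  fixes A :: "5 set"
  assumes "A \<noteq> {}" "g \<noteq> 0"
  shows "min 5 (Suc (card A)) \<le> card (A \<union> (+) g ` A)"
proof (cases "(+) g ` A \<subseteq> A")
  case True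
  obtain a where a: "a \<in> A" using assms by blast
  have step: "of_nat n * g + a \<in> A" for n
  proof (induction n)
    case (Suc n)
    then have "g + (of_nat n * g + a) \<in> A" using True by blast
    then show ?case by (simp add: algebra_simps)
  qed (use a in simp)
  have "x \<in> A" for x
  proof -
    \<comment> \<open>\<open>g ^ 3\<close> is the inverse of \<open>g\<close>, so \<open>n\<close> steps of \<open>g\<close> lead from \<open>a\<close> to \<open>x\<close>.\<close>
    obtain n where n: "(x - a) * g ^ 3 = of_nat n" using F5_of_nat_surj by blast
    have "of_nat n * g = (x - a) * g ^ 4"
      unfolding n[symmetric] by (simp add: eval_nat_numeral mult.assoc)
    then show ?thesis using step[of n] F5_power_4[OF assms(2)] by simp
  qed
  then have "A = UNIV" by blast
  then show ?thesis by simp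
next
  case False
  then have "A \<subset> A \<union> (+) g ` A" by blast
  then have "card A < card (A \<union> (+) g ` A)" by (intro psubset_card_mono) simp_all
  then show ?thesis by simp
qed

lemma zero_in_subsums: "0 \<in> subsums M"
  using subsumsI[of "{#}" M] by simp

lemma subsums_add_mset:
  "subsums M \<union> (+) g ` subsums M \<subseteq> subsums (add_mset g M)"
proof -
  have "sum_mset T \<in> subsums (add_mset g M)" "g + sum_mset T \<in> subsums (add_mset g M)"
    if "T \<subseteq># M" for T
  proof -
    have "T \<subseteq># add_mset g M"
      using that mset_subset_eq_add_right[of M "{#g#}"] subset_mset.order_trans by fastforce
    then show "sum_mset T \<in> subsums (add_mset g M)" by (rule subsumsI)
    have "add_mset g T \<subseteq># add_mset g M" using that by simp
    then show "g + sum_mset T \<in> subsums (add_mset g M)"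
      using subsumsI[of "add_mset g T" "add_mset g M"] by simp
  qed
  then show ?thesis by (auto simp: subsums_def)
qed

lemma card_subsums_step:
  fixes M :: "5 multiset"
  assumes "g \<noteq> 0"
  shows "min 5 (Suc (card (subsums M))) \<le> card (subsums (add_mset g M))"
proof -
  have "min 5 (Suc (card (subsums M))) \<le> card (subsums M \<union> (+) g ` subsums M)"
    using card_Un_shift[OF _ assms, of "subsums M"] zero_in_subsums[of M] by blast
  also have "\<dots> \<le> card (subsums (add_mset g M))"
    using subsums_add_mset by (intro card_mono) simp_all
  finally show ?thesis .
qed

text \<open>
  Each nonzero term adds at least one element until the field is exhausted. In the
  application, \<open>A\<close> is the set of products of the orders of one sequence, and \<open>M\<close> consists of
  central elements by which they can be multiplied.
\<close>

lemma card_plus_subsums: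
  fixes A :: "5 set" and M :: "5 multiset"
  assumes "A \<noteq> {}" "0 \<notin># M"
  shows "min 5 (card A + size M) \<le> card {a + s | a s. a \<in> A \<and> s \<in> subsums M}"
  using assms(2)
proof (induction M)
  case empty
  have "subsums {#} = {0 :: 5}" by (auto simp: subsums_def)
  then show ?case by simp
next
  case (add g M)
  let ?B = "\<lambda>M. {a + s | a s. a \<in> A \<and> s \<in> subsums M}"
  have "?B M \<noteq> {}" using assms(1) zero_in_subsums by blast
  then have "min 5 (Suc (card (?B M))) \<le> card (?B M \<union> (+) g ` ?B M)"
    using add.prems by (intro card_Un_shift) auto
  also have "?B M \<union> (+) g ` ?B M \<subseteq> ?B (add_mset g M)"
  proof -
    have "a + s \<in> ?B (add_mset g M)" "g + (a + s) \<in> ?B (add_mset g M)"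
      if "a \<in> A" "s \<in> subsums M" for a s
    proof -
      have *: "s \<in> subsums (add_mset g M)" "g + s \<in> subsums (add_mset g M)"
        using subsums_add_mset[of M g] that by auto
      then show "a + s \<in> ?B (add_mset g M)" using that(1) by blast
      have "g + (a + s) = a + (g + s)" by (simp add: algebra_simps)
      then show "g + (a + s) \<in> ?B (add_mset g M)" using that(1) *(2) by blast
    qed
    then show ?thesis by blast
  qed
  then have "card (?B M \<union> (+) g ` ?B M) \<le> card (?B (add_mset g M))" by (intro card_mono) simp_all
  finally show ?case using add by (simp add: min_def split: if_splits)
qed

corollary card_subsums:
  fixes M :: "5 multiset"
  assumes "0 \<notin># M"
  shows "min 5 (Suc (size M)) \<le> card (subsums M)"
proof -
  have "{a + s | a s. a \<in> {0} \<and> s \<in> subsums M} = subsums M" by auto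
  then show ?thesis using card_plus_subsums[OF _ assms, of "{0}"] by simp
qed

lemma not_zero_sum_free_F5:
  fixes M :: "5 multiset"
  assumes "5 \<le> size M"
  shows "\<not> zero_sum_free M"
proof
  assume free: "zero_sum_free M"
  have nz: "0 \<notin># M"
    by (rule zero_sum_free_nonzero[OF free])
  obtain g N where M: "M = add_mset g N" using assms by (cases M) auto
  have "subsums N = UNIV"
    using card_subsums[of N] nz assms M by (intro F5_set_eq_UNIV) auto
  then have "- g \<in> subsums N" by simp
  then obtain T where "T \<subseteq># N" "sum_mset T = - g" by (rule subsumsE)
  then have "add_mset g T \<subseteq># M" "sum_mset (add_mset g T) = 0" using M by auto
  from zero_sum_freeD[OF free this] show False by simp
qed

text \<open>
  The extremal zero-sum free sequences over the field are constant. Two distinct terms already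
  have four subsequence sums, a third term then makes every element a sum, and among these is
  the negative of a fourth term.
\<close>

lemma zero_sum_free_size_4_equal:
  fixes M :: "5 multiset"
  assumes free: "zero_sum_free M" and size: "4 \<le> size M" and ab: "a \<in># M" "b \<in># M"
  shows "a = b"
proof (rule ccontr)
  assume "a \<noteq> b"
  have nz: "0 \<notin># M"
    by (rule zero_sum_free_nonzero[OF free])
  obtain M' where M': "M = add_mset a M'" using ab(1) by (meson multi_member_split)
  then have "b \<in># M'" using ab(2) \<open>a \<noteq> b\<close> by simp
  then obtain N where N: "M = add_mset a (add_mset b N)" using M' by (metis multi_member_split)
  obtain c N' where N': "N = add_mset c N'" using size N by (cases N) auto
  obtain d where d: "d \<in># N'" using size N N' by (cases N') auto
  have "{#a, b#} \<subseteq># M" using N by simp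
  then have "a + b \<noteq> 0" using zero_sum_freeD[OF free, of "{#a, b#}"] by auto
  moreover have "{0, a, b, a + b} \<subseteq> subsums {#a, b#}"
  proof -
    have "{#} \<subseteq># {#a, b#}" "{#a#} \<subseteq># {#a, b#}" "{#b#} \<subseteq># {#a, b#}" "{#a, b#} \<subseteq># {#a, b#}"
      by simp_all
    from this[THEN subsumsI] show ?thesis by simp
  qed
  then have "card {0, a, b, a + b} \<le> card (subsums {#a, b#})" by (intro card_mono) simp_all
  moreover have "card {0, a, b, a + b} = 4"
    using \<open>a \<noteq> b\<close> \<open>a + b \<noteq> 0\<close> nz N by auto
  ultimately have "5 \<le> card (subsums {#c, a, b#})"
    using card_subsums_step[of c "{#a, b#}"] nz N N' by auto
  then have "- d \<in> subsums {#c, a, b#}" using F5_set_eq_UNIV[of "subsums {#c, a, b#}"] by simp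
  then obtain T where T: "T \<subseteq># {#c, a, b#}" "sum_mset T = - d" by (rule subsumsE)
  obtain N'' where "N' = add_mset d N''" using d by (meson multi_member_split)
  then have M: "M = add_mset d ({#c, a, b#} + N'')" using N N' by (simp add: add_mset_commute)
  have "T \<subseteq># {#c, a, b#} + N''" using T(1) by (rule subset_mset.add_increasing2[OF subset_mset.zero_le])
  then have "add_mset d T \<subseteq># M" unfolding M by (subst mset_subset_eq_add_mset_cancel)
  from zero_sum_freeD[OF free this] T(2) show False by simp
qed

text \<open>
  Equivalently, all but at most three terms can be chosen with sum 0. The complement of a
  longest zero-sum subsequence has at most four terms; if it has four, then it is constant,
  and by exchange so is the whole sequence, of a length congruent to 4.
\<close>

lemma short_subset_of_same_sum:
  fixes M :: "5 multiset"
  assumes nz: "0 \<notin># M" and size: "size M mod 5 \<noteq> 4"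
  shows "\<exists>C. C \<subseteq># M \<and> sum_mset C = sum_mset M \<and> size C \<le> 3"
proof -
  obtain T where T: "max_zero_sum M T" using ex_max_zero_sum by blast
  then have TM: "T \<subseteq># M" "sum_mset T = 0" by (auto simp: max_zero_sum_def)
  define C where "C = M - T"
  have free: "zero_sum_free C" unfolding C_def by (rule max_zero_sum_complement[OF T])
  have C: "C \<subseteq># M" "sum_mset C = sum_mset M" using TM by (auto simp: C_def sum_mset_diff)
  have "size C \<le> 3"
  proof (rule ccontr)
    assume "\<not> size C \<le> 3"
    moreover have "size C < 5" using not_zero_sum_free_F5 free by (meson not_less)
    ultimately have 4: "size C = 4" by simp
    then obtain a where a: "a \<in># C" by (cases C) auto
    have inC: "x \<in># C" if "x \<in># M" for x
    proof (cases "x \<in># T")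
      case True
      then show ?thesis
        using exchange_single[OF not_zero_sum_free_F5 nz T] 4 unfolding C_def by simp
    next
      case False
      then show ?thesis using that TM(1) unfolding C_def by (simp add: in_diff_count not_in_iff)
    qed
    have "x = a" if "x \<in># M" for x
      using zero_sum_free_size_4_equal[OF free _ inC[OF that] a] 4 by simp
    then have sum: "sum_mset N = of_nat (size N) * a" if "N \<subseteq># M" for N
      using that
    proof (induction N)
      case (add x N)
      then have "x = a" "N \<subseteq># M" by (auto dest: mset_subset_eq_insertD)
      then show ?case using add by (simp add: algebra_simps)
    qed simp
    have "of_nat (size M) * a = 4 * a" using sum[of M] sum[OF C(1)] C(2) 4 by simp
    then have "(of_nat (size M) - 4) * a = 0" by (simp add: algebra_simps)
    moreover have "a \<noteq> 0" using a nz C(1) by (metis mset_subset_eqD)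
    ultimately have "of_nat (size M mod 5) = (4::5)"
      by (simp add: F5_mult_eq_0 F5_of_nat_mod)
    moreover have "size M mod 5 \<in> {0, 1, 2, 3}" using size by auto
    ultimately show False by auto
  qed
  then show ?thesis using C by blast
qed

section \<open>Orderings of a sequence of vectors\<close>

definition det2 :: "5 \<times> 5 \<Rightarrow> 5 \<times> 5 \<Rightarrow> 5" where
  "det2 u v = fst u * snd v - snd u * fst v"

lemma det2_simps [simp]:
  "det2 (u + u') v = det2 u v + det2 u' v" "det2 u (v + v') = det2 u v + det2 u v'"
  "det2 (u - u') v = det2 u v - det2 u' v" "det2 u (v - v') = det2 u v - det2 u v'"
  "det2 (- u) v = - det2 u v" "det2 u (- v) = - det2 u v"
  "det2 0 v = 0" "det2 u 0 = 0" "det2 u u = 0"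
  by (auto simp: det2_def algebra_simps)

lemma det2_commute: "det2 u v = - det2 v u"
  by (simp add: det2_def algebra_simps)

lemma det2_eq_0_trans: "det2 v u = 0 \<Longrightarrow> det2 v w = 0 \<Longrightarrow> v \<noteq> 0 \<Longrightarrow> det2 u w = 0"
proof -
  assume *: "det2 v u = 0" "det2 v w = 0" "v \<noteq> 0"
  have "fst v * det2 u w = fst u * det2 v w - fst w * det2 v u"
    "snd v * det2 u w = snd u * det2 v w - snd w * det2 v u"
    by (simp_all add: det2_def algebra_simps)
  then have "fst v * det2 u w = 0" "snd v * det2 u w = 0" using * by simp_all
  then show ?thesis using *(3) by (auto simp: F5_mult_eq_0 prod_eq_iff)
qed

lemma det2_sum_mset: "det2 v (sum_mset M) = sum_mset (image_mset (det2 v) M)"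
  by (induction M) auto

lemma det2_sum_mset_zero: "(\<And>w. w \<in># M \<Longrightarrow> det2 v w = 0) \<Longrightarrow> det2 v (sum_mset M) = 0"
  by (induction M) auto

text \<open>
  Twice the signed area enclosed by the path with the given steps and its chord. The product
  of elements of the Heisenberg group depends on their order only through this number.
\<close>

fun area :: "(5 \<times> 5) list \<Rightarrow> 5" where
  "area [] = 0"
| "area (u # us) = det2 u (sum_list us) + area us"

lemma area_append: "area (us @ vs) = area us + area vs + det2 (sum_list us) (sum_list vs)"
  by (induction us) (auto simp: algebra_simps)

lemma area_parallel:
  "(\<And>u v. u \<in> set us \<Longrightarrow> v \<in> set us \<Longrightarrow> det2 u v = 0) \<Longrightarrow> area us = 0"
proof (induction us)
  case (Cons u us)
  then have "det2 u (sum_mset (mset us)) = 0" by (intro det2_sum_mset_zero) simp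
  then show ?case using Cons by (simp add: sum_mset_sum_list)
qed simp

definition areas :: "(5 \<times> 5) multiset \<Rightarrow> 5 set" where
  "areas T = {area us | us. mset us = T}"

text \<open>
  For nonzero vectors the negation means that all of them lie on one line, by \<open>det2_eq_0_trans\<close>.
\<close>

definition spanning :: "(5 \<times> 5) multiset \<Rightarrow> bool" where
  "spanning M \<longleftrightarrow> (\<exists>u \<in># M. \<exists>v \<in># M. det2 u v \<noteq> 0)"

lemma areasI: "mset us = T \<Longrightarrow> area us \<in> areas T"
  unfolding areas_def by blast

lemma areas_nonempty: "areas T \<noteq> {}"
  using ex_mset[of T] by (auto simp: areas_def)

lemma areas_add_mset:
  "(+) (det2 u (sum_mset M)) ` areas M \<subseteq> areas (add_mset u M)"
  "(+) (- det2 u (sum_mset M)) ` areas M \<subseteq> areas (add_mset u M)"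
proof -
  have "det2 u (sum_mset (mset us)) + area us \<in> areas (add_mset u (mset us))" for us
    unfolding areas_def using sum_mset_sum_list[of us]
    by (intro CollectI exI[of _ "u # us"]) simp
  then show "(+) (det2 u (sum_mset M)) ` areas M \<subseteq> areas (add_mset u M)"
    by (auto simp: areas_def)
  have "- det2 u (sum_mset (mset us)) + area us \<in> areas (add_mset u (mset us))" for us
    unfolding areas_def using sum_mset_sum_list[of us] det2_commute[of u "sum_list us"]
    by (intro CollectI exI[of _ "us @ [u]"]) (simp add: area_append)
  then show "(+) (- det2 u (sum_mset M)) ` areas M \<subseteq> areas (add_mset u M)"
    by (auto simp: areas_def)
qed

text \<open>
  With all vectors of \<open>M\<close> on one line, the area of an order depends only on which of them
  precede \<open>b\<close>: it is an affine function of the sum of the numbers \<open>det2 b v\<close> over these.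
\<close>

lemma card_areas_two_lines:
  assumes par: "\<And>u v. u \<in># M \<Longrightarrow> v \<in># M \<Longrightarrow> det2 u v = 0"
    and transv: "\<And>v. v \<in># M \<Longrightarrow> det2 b v \<noteq> 0"
  shows "min 5 (Suc (size M)) \<le> card (areas (add_mset b M))"
proof -
  let ?D = "image_mset (det2 b) M"
  let ?f = "\<lambda>s. det2 b (sum_mset M) - 2 * s"
  have "?f ` subsums ?D \<subseteq> areas (add_mset b M)"
  proof (rule image_subsetI)
    fix s assume "s \<in> subsums ?D"
    then obtain T where T: "T \<subseteq># ?D" "s = sum_mset T" by (auto simp: subsums_def)
    then obtain J where J: "J \<subseteq># M" "T = image_mset (det2 b) J"
      using subseteq_image_mset by blast
    obtain xs where xs: "mset xs = J" using ex_mset by blast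
    obtain ys where ys: "mset ys = M - J" using ex_mset by blast
    have set: "u \<in># M" if "u \<in> set xs \<or> u \<in> set ys" for u
      using that xs ys J(1) by (metis in_diffD mset_subset_eqD set_mset_mset)
    then have "area xs = 0" "area ys = 0" by (auto intro!: area_parallel par)
    moreover have "det2 (sum_list xs) (sum_list ys) = 0"
      using det2_sum_mset_zero[of "mset ys"] det2_sum_mset_zero[of "mset xs"] par set
        det2_commute[of "sum_list xs"] det2_commute[of "sum_list ys"]
      by (metis neg_equal_0_iff_equal set_mset_mset sum_mset_sum_list)
    moreover have "s = det2 b (sum_list xs)" using J T xs det2_sum_mset sum_mset_sum_list by metis
    moreover have "sum_mset M = sum_list xs + sum_list ys"
      using xs ys J(1) by (metis subset_mset.add_diff_inverse sum_mset.union sum_mset_sum_list)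
    ultimately have "area (xs @ b # ys) = ?f s"
      using det2_commute[of "sum_list xs" b] by (simp add: area_append)
    moreover have "mset (xs @ b # ys) = add_mset b M" using xs ys J(1) by simp
    ultimately show "?f s \<in> areas (add_mset b M)" using areasI by metis
  qed
  then have "card (?f ` subsums ?D) \<le> card (areas (add_mset b M))" by (intro card_mono) simp_all
  moreover have "inj_on ?f (subsums ?D)"
  proof (rule inj_onI)
    fix s t assume eq: "?f s = ?f t"
    have "2 * (s - t) = ?f t - ?f s" by (simp add: algebra_simps)
    also have "\<dots> = 0" unfolding eq by (rule diff_self)
    finally have "(2::5) = 0 \<or> s - t = 0" by (simp only: F5_mult_eq_0)
    then show "s = t" by simp
  qed
  moreover have "0 \<notin># ?D" using transv by auto
  ultimately show ?thesis
    using card_subsums[of ?D] by (simp add: card_image)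
qed

text \<open>
  Choose \<open>b\<close> off the line of the total sum \<open>\<sigma>\<close>. The orders in which \<open>b\<close> comes first and those in
  which it comes last give two translates, by \<open>det2 b \<sigma>\<close> and its negative, of the set of areas of
  the other vectors, so the number of areas grows by at least one until it is 5. This
  induction stops working only when the other vectors lie on one line, which is the preceding
  lemma.
\<close>

lemma card_areas_nonzero_sum:
  assumes "0 \<notin># M" "spanning M" "sum_mset M \<noteq> 0"
  shows "min 5 (size M) \<le> card (areas M)"
  using assms
proof (induction "size M" arbitrary: M rule: less_induct)
  case less
  define \<sigma> where "\<sigma> = sum_mset M"
  have "\<exists>b \<in># M. det2 \<sigma> b \<noteq> 0"
    using det2_eq_0_trans[of \<sigma>] less.prems(2,3) unfolding spanning_def \<sigma>_def by blast
  then obtain b where b: "b \<in># M" "det2 b \<sigma> \<noteq> 0" using det2_commute[of \<sigma>] by auto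
  then obtain N where M: "M = add_mset b N" by (meson multi_member_split)
  have bN: "det2 b (sum_mset N) = det2 b \<sigma>" using M by (simp add: \<sigma>_def)
  show ?case
  proof (cases "spanning N")
    case True
    have "sum_mset N \<noteq> 0" using bN b by auto
    then have IH: "min 5 (size N) \<le> card (areas N)"
      using less.hyps[of N] less.prems(1) True M by simp
    let ?A = "(+) (- det2 b \<sigma>) ` areas N"
    have "(+) (2 * det2 b \<sigma>) ` ?A = (+) (det2 b \<sigma>) ` areas N"
      by (auto simp: image_image algebra_simps)
    then have "?A \<union> (+) (2 * det2 b \<sigma>) ` ?A \<subseteq> areas M"
      using areas_add_mset[where u = b and M = N] bN M by simp
    then have "card (?A \<union> (+) (2 * det2 b \<sigma>) ` ?A) \<le> card (areas M)" by (intro card_mono) simp_all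
    moreover have "min 5 (Suc (card ?A)) \<le> card (?A \<union> (+) (2 * det2 b \<sigma>) ` ?A)"
      using b(2) areas_nonempty by (intro card_Un_shift) (auto simp: F5_mult_eq_0)
    moreover have "card ?A = card (areas N)" by (simp add: card_image)
    ultimately show ?thesis using IH M by simp
  next
    case False
    then have par: "det2 u v = 0" if "u \<in># N" "v \<in># N" for u v
      using that by (auto simp: spanning_def)
    have "det2 b v \<noteq> 0" if v: "v \<in># N" for v
    proof
      assume "det2 b v = 0"
      moreover have "det2 v (sum_mset N) = 0" using par v by (intro det2_sum_mset_zero)
      moreover have "v \<noteq> 0" using v M less.prems(1) by auto
      ultimately have "det2 b (sum_mset N) = 0"
        using det2_eq_0_trans[of v b] det2_commute[of v b] by simp
      then show False using bN b by simp
    qed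
    then show ?thesis using card_areas_two_lines[of N b] par M by simp
  qed
qed

text \<open>
  The area of a closed polygon does not change when its last edge is left out.
\<close>

lemma areas_add_mset_zero_sum:
  assumes "sum_mset (add_mset t N) = 0"
  shows "areas N \<subseteq> areas (add_mset t N)"
proof -
  have "sum_mset N = - t" using assms by (simp add: eq_neg_iff_add_eq_0 add.commute)
  then show ?thesis using areas_add_mset(1)[of t N] by simp
qed

text \<open>
  Leave out one of two independent terms. The others still span the plane, their sum is not 0,
  and their areas are areas of the whole sequence. The loss of 1 compared with a nonzero sum
  is real: a triangle has only two areas.
\<close>

lemma card_areas_zero_sum:
  assumes "0 \<notin># T" "spanning T" "sum_mset T = 0"
  shows "min 5 (size T - 1) \<le> card (areas T)"
proof -
  obtain u v where uv: "u \<in># T" "v \<in># T" "det2 u v \<noteq> 0" using assms(2) by (auto simp: spanning_def)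
  obtain N where T: "T = add_mset u N" using uv(1) by (meson multi_member_split)
  have sumN: "sum_mset N = - u" using assms(3) T by (simp add: eq_neg_iff_add_eq_0 add.commute)
  have vN: "v \<in># N" using uv T by auto
  have "spanning N"
  proof (rule ccontr)
    assume "\<not> spanning N"
    then have "det2 v (sum_mset N) = 0" using vN by (intro det2_sum_mset_zero) (auto simp: spanning_def)
    then show False using sumN uv(3) det2_commute[of u v] by simp
  qed
  moreover have "sum_mset N \<noteq> 0" using sumN assms(1) T by auto
  ultimately have "min 5 (size N) \<le> card (areas N)"
    using assms(1) T by (intro card_areas_nonzero_sum) auto
  also have "\<dots> \<le> card (areas T)"
    unfolding T using areas_add_mset_zero_sum assms(3) T by (intro card_mono) auto
  finally show ?thesis using T by simp
qed

text \<open>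
  For length 5 the preceding bound gives four areas only. For \<open>t\<^sup>2 s\<^sup>2 c\<close> all five occur, because
  the words in two letters \<open>t\<close> and two letters \<open>s\<close> have all numbers of inversions from 0 to 4, and
  each inversion changes the area by the same amount.
\<close>

lemma areas_two_squares:
  assumes "det2 t s \<noteq> 0" "sum_mset {#t, t, s, s, c#} = 0"
  shows "areas {#t, t, s, s, c#} = UNIV"
proof -
  define N where "N = {#t, t, s, s#}"
  have T: "{#t, t, s, s, c#} = add_mset c N" by (simp add: N_def add_mset_commute)
  let ?d = "det2 t s"
  have "{area [t, t, s, s], area [t, s, t, s], area [t, s, s, t], area [s, t, s, t], area [s, s, t, t]}
    \<subseteq> areas N"
    unfolding insert_subset N_def by (intro conjI areasI) (simp_all add: add_mset_commute)
  moreover have "{area [t, t, s, s], area [t, s, t, s], area [t, s, s, t], area [s, t, s, t], area [s, s, t, t]}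
    = {4 * ?d, 2 * ?d, 0, - 2 * ?d, - 4 * ?d}"
    using det2_commute[of s t] by (simp add: algebra_simps)
  moreover have "\<forall>d::5. d \<noteq> 0 \<longrightarrow> 5 \<le> card {4 * d, 2 * d, 0, - 2 * d, - 4 * d}"
    unfolding F5_all by simp
  ultimately have "5 \<le> card {4 * ?d, 2 * ?d, 0, - 2 * ?d, - 4 * ?d}"
    and "{4 * ?d, 2 * ?d, 0, - 2 * ?d, - 4 * ?d} \<subseteq> areas N"
    using assms(1) by (blast, simp only:)
  then have "5 \<le> card (areas N)" using card_mono[OF finite] order_trans by blast
  then have "areas N = UNIV" by (rule F5_set_eq_UNIV)
  then show ?thesis using areas_add_mset_zero_sum[of c N] assms(2) unfolding T by auto
qed

section \<open>Zero-sum sequences of vectors with many areas\<close>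

lemma double_eq_0: "u + u = 0 \<longleftrightarrow> u = 0" for u :: "5 \<times> 5"
proof -
  have "\<forall>x::5. x + x = 0 \<longleftrightarrow> x = 0" unfolding F5_all by simp
  then show ?thesis by (simp add: prod_eq_iff)
qed

text \<open>
  For a sum of 0 the set of subsequence sums is symmetric and contains 0, so its size is odd.
  This improves the bound 4 for three terms to 5.
\<close>

lemma subsums_zero_sum:
  fixes M :: "5 multiset"
  assumes "0 \<notin># M" "3 \<le> size M" "sum_mset M = 0"
  shows "subsums M = UNIV"
proof (rule ccontr)
  assume "subsums M \<noteq> UNIV"
  then obtain m where m: "m \<notin> subsums M" by blast
  have "- m \<notin> subsums M"
  proof
    assume "- m \<in> subsums M"
    then obtain T where T: "T \<subseteq># M" "sum_mset T = - m" by (rule subsumsE)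
    then have "sum_mset (M - T) = m" using assms(3) by (simp add: sum_mset_diff)
    then show False using m subsumsI[of "M - T" M] by simp
  qed
  moreover have "m \<noteq> 0" using m zero_in_subsums[of M] by metis
  then have "m \<noteq> - m"
  proof -
    have "\<forall>x::5. x = - x \<longrightarrow> x = 0" unfolding F5_all by simp
    then show ?thesis using \<open>m \<noteq> 0\<close> by blast
  qed
  ultimately have "card (UNIV - {m, - m}) = 3" "subsums M \<subseteq> UNIV - {m, - m}"
    using m by (simp add: card_Diff_subset, blast)
  then have "card (subsums M) \<le> 3" by (metis card_mono finite)
  then show False using card_subsums[OF assms(1)] assms(2) by simp
qed

text \<open>
  A linear form \<open>det2 v'\<close> that does not vanish at \<open>v\<close> is a coordinate on the line through \<open>v\<close>.
\<close>

lemma parallel_eq: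
  assumes "det2 v' v \<noteq> 0" "det2 v x = det2 v y" "det2 v' x = det2 v' y"
  shows "x = y"
proof (rule ccontr)
  assume "x \<noteq> y"
  then have "x - y \<noteq> 0" by simp
  moreover have "det2 (x - y) v' = 0" "det2 (x - y) v = 0"
    using assms(2,3) det2_commute[of "x - y"] by simp_all
  ultimately show False using det2_eq_0_trans assms(1) by blast
qed

lemma ex_transversal: "v \<noteq> 0 \<Longrightarrow> \<exists>v'. det2 v' v \<noteq> 0"
proof -
  assume "v \<noteq> 0"
  moreover have "det2 (0, 1) v = - fst v" "det2 (1, 0) v = snd v" by (simp_all add: det2_def)
  ultimately show ?thesis by (metis neg_equal_0_iff_equal prod_eq_iff zero_prod_def fst_conv snd_conv)
qed

lemma subsums_line:
  assumes v: "det2 v' v \<noteq> 0" and par: "\<And>u. u \<in># M \<Longrightarrow> det2 v u = 0"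
    and all: "subsums (image_mset (det2 v') M) = UNIV" and w: "det2 v w = 0"
  shows "\<exists>R. R \<subseteq># M \<and> sum_mset R = w"
proof -
  have "det2 v' w \<in> subsums (image_mset (det2 v') M)" using all by simp
  then obtain T where "T \<subseteq># image_mset (det2 v') M" "sum_mset T = det2 v' w" by (rule subsumsE)
  then obtain R where R: "R \<subseteq># M" "det2 v' (sum_mset R) = det2 v' w"
    using subseteq_image_mset det2_sum_mset by metis
  moreover have "det2 v (sum_mset R) = 0"
    using par R(1) by (intro det2_sum_mset_zero) (auto dest: mset_subset_eqD)
  ultimately have "sum_mset R = w" using parallel_eq[OF v] w by simp
  then show ?thesis using R by blast
qed

lemma parallel_nonzero:
  assumes "det2 v' v \<noteq> 0" "0 \<notin># M" "\<And>u. u \<in># M \<Longrightarrow> det2 v u = 0"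
  shows "0 \<notin># image_mset (det2 v') M"
  using parallel_eq[OF assms(1), of _ 0] assms(2,3) by force

lemma ex_subset_size: "m \<le> size M \<Longrightarrow> \<exists>A. A \<subseteq># M \<and> size A = m"
proof (induction m)
  case (Suc m)
  then obtain A where A: "A \<subseteq># M" "size A = m" by auto
  then have "size (M - A) \<noteq> 0" using Suc.prems by (simp add: size_Diff_submset)
  then obtain x where "x \<in># M - A" by (metis multiset_nonemptyE size_empty)
  then have "A + {#x#} \<subseteq># A + (M - A)"
    by (intro subset_mset.add_left_mono) simp
  then have "add_mset x A \<subseteq># M" using A by simp
  then show ?case using A by (metis size_add_mset)
qed auto

text \<open>
  Four terms on the line suffice to represent any point of it. Representing the complementary
  sum in this way and leaving those terms out represents \<open>w\<close> by a long subsequence.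
\<close>

lemma long_line_sum:
  assumes v: "v \<noteq> 0" and M: "0 \<notin># M" "4 \<le> size M" and par: "\<And>u. u \<in># M \<Longrightarrow> det2 v u = 0"
    and w: "det2 v w = 0"
  shows "\<exists>P. P \<subseteq># M \<and> sum_mset P = w \<and> size M \<le> size P + 4"
proof -
  obtain v' where v': "det2 v' v \<noteq> 0" using ex_transversal[OF v] by blast
  obtain A where A: "A \<subseteq># M" "size A = 4" using ex_subset_size[OF M(2)] by blast
  have A': "0 \<notin># A" "\<And>u. u \<in># A \<Longrightarrow> det2 v u = 0" using A M par by (auto dest: mset_subset_eqD)
  have "5 \<le> card (subsums (image_mset (det2 v') A))"
    using card_subsums[OF parallel_nonzero[OF v' A']] A(2) by simp
  then have "subsums (image_mset (det2 v') A) = UNIV" by (rule F5_set_eq_UNIV)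
  moreover have "det2 v (sum_mset M - w) = 0" using w par det2_sum_mset_zero by simp
  ultimately obtain R where R: "R \<subseteq># A" "sum_mset R = sum_mset M - w"
    using subsums_line[OF v' A'(2)] by blast
  have "R \<subseteq># M" using R A by (meson subset_mset.order_trans)
  moreover have "size R \<le> 4" using R A size_mset_mono by metis
  ultimately show ?thesis
    using R by (intro exI[of _ "M - R"]) (simp add: sum_mset_diff size_Diff_submset)
qed

lemma zero_sum_line_sum:
  assumes v: "v \<noteq> 0" and T: "0 \<notin># T" "3 \<le> size T" "sum_mset T = 0"
    and par: "\<And>u. u \<in># T \<Longrightarrow> det2 v u = 0" and w: "det2 v w = 0"
  shows "\<exists>P. P \<subseteq># T \<and> P \<noteq> {#} \<and> sum_mset P = w"
proof (cases "w = 0")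
  case True
  then show ?thesis using T by (intro exI[of _ T]) auto
next
  case False
  obtain v' where v': "det2 v' v \<noteq> 0" using ex_transversal[OF v] by blast
  have "subsums (image_mset (det2 v') T) = UNIV"
    using parallel_nonzero[OF v' T(1) par] T det2_sum_mset[of v' T] by (intro subsums_zero_sum) auto
  then obtain P where "P \<subseteq># T" "sum_mset P = w"
    using subsums_line[OF v' par _ w] by blast
  then show ?thesis using False by auto
qed

text \<open>
  Modulo the line through \<open>v\<close>, all but at most three of the vectors off the line can be taken
  with sum 0. Their sum is then a point of the line, and vectors on the line cancel it. Since
  both parts are nonempty, the result is spanning.
\<close>

lemma long_spanning_zero_sum:
  fixes N :: "(5 \<times> 5) multiset" and v :: "5 \<times> 5"
  defines "L \<equiv> filter_mset (\<lambda>w. det2 v w = 0) N" and "M \<equiv> filter_mset (\<lambda>w. det2 v w \<noteq> 0) N"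
  assumes nz: "0 \<notin># N" and v: "v \<noteq> 0" and M: "4 \<le> size M" "size M mod 5 \<noteq> 4"
    and cover: "\<And>w. det2 v w = 0 \<Longrightarrow> \<exists>P. P \<subseteq># L \<and> P \<noteq> {#} \<and> sum_mset P = w \<and> size L \<le> size P + 4"
  shows "\<exists>T. T \<subseteq># N \<and> sum_mset T = 0 \<and> spanning T \<and> size N \<le> size T + 7"
proof -
  have N: "N = L + M" by (simp add: L_def M_def)
  have "0 \<notin># image_mset (det2 v) M" by (auto simp: M_def)
  then obtain C where C: "C \<subseteq># image_mset (det2 v) M"
      "sum_mset C = sum_mset (image_mset (det2 v) M)" "size C \<le> 3"
    using short_subset_of_same_sum[of "image_mset (det2 v) M"] M(2) by auto
  obtain J where J: "J \<subseteq># M" "image_mset (det2 v) J = C" using subseteq_image_mset[OF C(1)] by blast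
  define W where "W = M - J"
  have "size J \<le> 3" using J C by auto
  then have W: "W \<subseteq># M" "size M \<le> size W + 3" using J by (auto simp: W_def size_Diff_submset)
  have "det2 v (sum_mset W) = 0"
    using J C(2) by (simp add: W_def sum_mset_diff det2_sum_mset)
  then have "det2 v (- sum_mset W) = 0" by simp
  from cover[OF this] obtain P where P: "P \<subseteq># L" "P \<noteq> {#}" "sum_mset P = - sum_mset W" "size L \<le> size P + 4"
    by blast
  have "P + W \<subseteq># N" unfolding N using P(1) W(1) by (rule subset_mset.add_mono)
  moreover have "sum_mset (P + W) = 0" using P(3) by simp
  moreover have "spanning (P + W)"
  proof -
    obtain p where p: "p \<in># P" using P(2) by blast
    have "W \<noteq> {#}" using W(2) M(1) by auto
    then obtain w where w: "w \<in># W" by blast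
    have "det2 v p = 0" "p \<noteq> 0" using p P(1) nz by (auto simp: L_def dest: mset_subset_eqD)
    moreover have "det2 v w \<noteq> 0" using w W(1) by (auto simp: M_def dest: mset_subset_eqD)
    ultimately have "det2 p w \<noteq> 0"
      using det2_eq_0_trans[of p v w] det2_commute[of v p] by auto
    then show ?thesis using p w by (auto simp: spanning_def)
  qed
  moreover have "size N \<le> size (P + W) + 7" using W(2) P(4) N by simp
  ultimately show ?thesis by blast
qed

text \<open>
  The exchange argument for a longest zero-sum subsequence \<open>T = t\<^sup>2 X\<close> with \<open>X\<close> free of
  repetitions, whose complement is as long as possible. The complement contains a subsequence
  \<open>A\<close> with sum \<open>2 t\<close>, and \<open>X A\<close> is a zero-sum subsequence too, so \<open>A\<close> has at most two terms. Every
  term of a longest zero-sum subsequence occurs once more in its complement. Hence \<open>A\<close> and \<open>X\<close>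
  share a term, since otherwise \<open>X A\<close> would be found inside the complement of \<open>T\<close>; and there are
  enough copies of every term to place \<open>T\<close> and \<open>X A\<close> side by side. Their union is a zero-sum
  subsequence longer than \<open>T\<close>. The cases in which this fails put five vectors on the line of \<open>t\<close>.
\<close>

lemma max_zero_sum_not_one_repetition:
  fixes N :: "(5 \<times> 5) multiset"
  assumes T: "max_zero_sum N T" "8 \<le> size (N - T)" and nz: "0 \<notin># N"
    and X: "T = add_mset t (add_mset t X)" "X \<noteq> {#}" "\<And>x. count X x \<le> 1"
    and line: "size (filter_mset (\<lambda>w. det2 t w = 0) N) \<le> 4"
  shows False
proof -
  have TN: "T \<subseteq># N" "sum_mset T = 0" using T by (auto simp: max_zero_sum_def)
  note free = max_zero_sum_complement[OF T(1)]
  have 9: "9 \<le> Suc (size (N - T))" using T(2) by simp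
  have tN: "t \<in># N" using TN X by (metis mset_subset_eqD union_single_eq_member add_mset_add_single)
  have XT: "X \<subseteq># T" using X by (metis mset_subset_eq_add_right add_mset_add_single union_commute subset_mset.order_trans)
  have more: "count T x < count N x" if "x \<in># T" for x
    using count_exchange_single[OF not_zero_sum_free_F5_plane nz T(1) 9 that] .
  have line': False if "size B \<ge> 5" "B \<subseteq># N" "\<And>w. w \<in># B \<Longrightarrow> det2 t w = 0" for B
  proof -
    have "filter_mset (\<lambda>w. det2 t w = 0) B = B" using that(3) by (simp add: filter_mset_eq_conv)
    then have "size B \<le> size (filter_mset (\<lambda>w. det2 t w = 0) N)"
      using that(2) multiset_filter_mono size_mset_mono by metis
    then show False using that(1) line by simp
  qed
  obtain A where A: "A \<subseteq># N - T" "sum_mset A = t + t"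
    using subsums_zero_sum_free[OF not_zero_sum_free_F5_plane free 9] by blast
  have TX: "T - X = {#t, t#}" using X(1) by simp
  have T2: "X + A \<subseteq># N" "sum_mset (X + A) = 0" "size (X + A) \<le> size T"
    using exchange[OF T(1) XT A(1)] A(2) unfolding TX by simp_all
  have "A \<noteq> {#}" using A(2) double_eq_0[of t] nz tN by auto
  have X_free: "X \<subseteq># N - T"
    unfolding subseteq_mset_def
  proof
    fix x show "count X x \<le> count (N - T) x"
      using X(3)[of x] more[of x] mset_subset_eq_count[OF XT, of x]
      by (cases "x \<in># T") (auto simp: not_in_iff)
  qed
  obtain p where p: "p \<in># X" "p \<in># A"
  proof -
    have "\<not> X + A \<subseteq># N - T"
      using zero_sum_freeD[OF free _ T2(2)] X(2) by auto
    then obtain x where x: "\<not> count X x + count A x \<le> count (N - T) x"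
      by (auto simp: subseteq_mset_def)
    then have "count X x \<noteq> 0" "count A x \<noteq> 0"
      using mset_subset_eq_count[OF X_free, of x] mset_subset_eq_count[OF A(1), of x] by auto
    then show ?thesis using that by simp
  qed
  have "size A \<le> 2" using T2(3) X(1) by simp
  moreover have "size A \<noteq> 0" using \<open>A \<noteq> {#}\<close> by simp
  ultimately consider "size A = 1" | "size A = 2" by linarith
  then show False
  proof cases
    case 1
    \<comment> \<open>Now \<open>A\<close> is \<open>2 t\<close> alone, and \<open>t\<^sup>3 (2 t)\<^sup>2\<close> lies on one line.\<close>
    then obtain q where "A = {#q#}" by (metis size_1_singleton_mset)
    then have "A = {#p#}" using p by simp
    then have pt: "p = t + t" using A(2) by simp
    then have "p \<noteq> t" using nz tN by auto
    have "3 \<le> count N t" using more[of t] X(1) by simp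
    moreover have "p \<in># T" using p X(1) by simp
    then have "2 \<le> count N p" using more[of p] count_greater_zero_iff[of T p] by linarith
    ultimately have "{#t, t, t, p, p#} \<subseteq># N"
      using \<open>p \<noteq> t\<close> unfolding subseteq_mset_def by auto
    then show False using pt by (intro line'[of "{#t, t, t, p, p#}"]) auto
  next
    case 2
    then have T2_max: "max_zero_sum N (X + A)" using T2 T(1) X(1) by (simp add: max_zero_sum_def)
    have "size (N - (X + A)) = size (N - T)" using T2(1) TN(1) 2 X(1) by (simp add: size_Diff_submset)
    then have more2: "count (X + A) x < count N x" if "x \<in># X + A" for x
      using count_exchange_single[OF not_zero_sum_free_F5_plane nz T2_max _ that] 9 by simp
    show False
    proof (cases "t \<in># A")
      case True
      then obtain B where B: "A = add_mset t B" by (meson multi_member_split)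
      then have "size B = 1" using 2 by simp
      then obtain q where "A = {#t, q#}" using B by (metis size_1_singleton_mset)
      then have At: "A = {#t, t#}" using A(2) by simp
      then have "t \<in># X" using p by auto
      then have "3 \<le> count T t" using X(1) by (simp add: Suc_le_eq)
      moreover have "2 \<le> count (N - T) t" using mset_subset_eq_count[OF A(1), of t] At by simp
      ultimately have "5 \<le> count N t" by simp
      then have "replicate_mset 5 t \<subseteq># N" by (simp only: count_le_replicate_mset_subset_eq)
      then show False by (intro line'[of "replicate_mset 5 t"]) auto
    next
      case False
      have "T + (X + A) \<subseteq># N"
        unfolding subseteq_mset_def
      proof
        fix e
        \<comment> \<open>Every term of \<open>T\<close>, and of \<open>X A\<close>, occurs once more in \<open>N\<close>, and \<open>X\<close> has no repetition.\<close>
        have "count T e + count (X + A) e \<le> count N e"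
          using more[of e] more2[of e] X(3)[of e] False mset_subset_eq_count[OF T2(1), of e] mset_subset_eq_count[OF TN(1), of e]
          by (cases "e = t"; cases "e \<in># X") (auto simp: X(1) not_in_iff)
        then show "count (T + (X + A)) e \<le> count N e" by simp
      qed
      moreover have "sum_mset (T + (X + A)) = 0" using TN T2 by simp
      ultimately have "size (T + (X + A)) \<le> size T" using T(1) unfolding max_zero_sum_def by blast
      then show False using 2 by simp
    qed
  qed
qed

text \<open>
  A zero-sum subsequence can have few areas in two ways: by being short, or by lying on a
  line. Since nine vectors always contain a zero-sum subsequence, a longest one, \<open>T\<close>, has at
  least \<open>size N - 8\<close> terms. If \<open>T\<close> is spanning, then \<open>card_areas_zero_sum\<close> is enough as soon as
  there is one more term. If no zero-sum subsequence has enough areas, then first no line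
  carries five vectors, since otherwise \<open>long_spanning_zero_sum\<close> applies to it. A \<open>T\<close> with more
  than \<open>size N - 8\<close> terms lies on a line, and \<open>long_spanning_zero_sum\<close> applies to that line. A \<open>T\<close>
  with exactly \<open>size N - 8\<close> terms has a complement of eight terms that contains every term of \<open>T\<close>,
  which is impossible if the terms of \<open>T\<close> are distinct. If it consists of two copies of a term
  and of distinct terms, among which that term may be again, then the preceding lemma excludes
  it. The remaining shapes are \<open>t\<^sup>2 s\<^sup>2 c\<close>, which has five areas or lies on a line, and \<open>t\<^sup>2 s\<^sup>2\<close>,
  where \<open>s = - t\<close> and both terms occur in the complement.
\<close>

theorem zero_sum_with_many_areas:
  fixes N :: "(5 \<times> 5) multiset"
  assumes nz: "0 \<notin># N" and size: "9 \<le> size N" "size N \<le> 13"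
    and lines: "\<And>v. v \<noteq> 0 \<Longrightarrow> size (filter_mset (\<lambda>w. det2 v w = 0) N) + 5 \<le> size N"
  shows "\<exists>T. T \<subseteq># N \<and> T \<noteq> {#} \<and> sum_mset T = 0 \<and> size N - 8 \<le> card (areas T)"
proof (rule ccontr)
  assume "\<not> ?thesis"
  then have few: "card (areas T) < size N - 8" if "T \<subseteq># N" "T \<noteq> {#}" "sum_mset T = 0" for T
    using that by (meson not_less)
  have nzT: "0 \<notin># T" if "T \<subseteq># N" for T using that nz by (auto dest: mset_subset_eqD)
  have short: "size T + 8 \<le> size N" if T: "T \<subseteq># N" "sum_mset T = 0" "spanning T" for T
  proof -
    have "T \<noteq> {#}" using T(3) by (auto simp: spanning_def)
    then show ?thesis
      using card_areas_zero_sum[OF nzT[OF T(1)] T(3,2)] few[OF T(1) _ T(2)] size(2) by (auto simp: min_def split: if_splits)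
  qed
  have mod_5_neq_4: "m mod 5 \<noteq> 4" if "5 \<le> m" "m \<le> 8" for m :: nat
    using that by presburger
  have split: "size N = size (filter_mset (\<lambda>w. det2 v w = 0) N) + size (filter_mset (\<lambda>w. det2 v w \<noteq> 0) N)" for v
    using multiset_partition[of N "\<lambda>w. det2 v w = 0"] by (metis size_union)
  have lines4: "size (filter_mset (\<lambda>w. det2 v w = 0) N) \<le> 4" if v: "v \<noteq> 0" for v
  proof (rule ccontr)
    let ?L = "filter_mset (\<lambda>w. det2 v w = 0) N" and ?M = "filter_mset (\<lambda>w. det2 v w \<noteq> 0) N"
    assume "\<not> size ?L \<le> 4"
    then have 5: "5 \<le> size ?L" by simp
    then have M58: "5 \<le> size ?M" "size ?M \<le> 8" using lines[OF v] split[of v] size(2) by auto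
    have M: "4 \<le> size ?M" "size ?M mod 5 \<noteq> 4"
      using M58(1) mod_5_neq_4[OF M58] by linarith+
    have cover: "\<exists>P. P \<subseteq># ?L \<and> P \<noteq> {#} \<and> sum_mset P = w \<and> size ?L \<le> size P + 4"
      if w: "det2 v w = 0" for w
    proof -
      obtain P where "P \<subseteq># ?L" "sum_mset P = w" "size ?L \<le> size P + 4"
      proof -
        have "0 \<notin># ?L" "4 \<le> size ?L" "\<And>u. u \<in># ?L \<Longrightarrow> det2 v u = 0" using nz 5 by simp_all
        from long_line_sum[OF v this w] that show thesis by blast
      qed
      then have "P \<subseteq># ?L \<and> P \<noteq> {#} \<and> sum_mset P = w \<and> size ?L \<le> size P + 4"
        using 5 by auto
      then show ?thesis ..
    qed
    obtain T where "T \<subseteq># N" "sum_mset T = 0" "spanning T" "size N \<le> size T + 7"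
      using long_spanning_zero_sum[OF nz v M cover] by blast
    then show False using short[of T] by simp
  qed
  obtain T where T: "max_zero_sum N T" using ex_max_zero_sum by blast
  then have TN: "T \<subseteq># N" "sum_mset T = 0" by (auto simp: max_zero_sum_def)
  note free = max_zero_sum_complement[OF T]
  have "size (N - T) < 9" using free not_zero_sum_free_F5_plane by (meson not_less)
  then have ge: "size N \<le> size T + 8" using TN(1) by (simp add: size_Diff_submset)
  then have "T \<noteq> {#}" using size(1) by auto
  then have "card (areas T) < size N - 8" using few TN by blast
  moreover have "card (areas T) \<noteq> 0" using areas_nonempty[of T] by simp
  ultimately have size10: "10 \<le> size N" by linarith
  show False
  proof (cases "size N = size T + 8")
    case True
    then have 8: "size (N - T) = 8" using TN(1) by (simp add: size_Diff_submset)
    have inR: "x \<in># N - T" if "x \<in># T" for x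
      using exchange_single[OF not_zero_sum_free_F5_plane nz T _ that] 8 by simp
    show False
    proof (cases "\<forall>x. count T x \<le> 1")
      case True
      have "T \<subseteq># N - T"
        unfolding subseteq_mset_def
      proof
        fix x show "count T x \<le> count (N - T) x"
        proof (cases "x \<in># T")
          case x: True
          then have "0 < count (N - T) x" using inR by (simp only: count_greater_zero_iff)
          then show ?thesis using True[rule_format, of x] by linarith
        qed (simp add: not_in_iff)
      qed
      then show False using zero_sum_freeD[OF free _ TN(2)] \<open>T \<noteq> {#}\<close> by blast
    next
      case False
      have twice: "\<exists>Y. X = add_mset x (add_mset x Y)" if "\<not> count X x \<le> 1" for X :: "(5 \<times> 5) multiset" and x
      proof -
        have "2 \<le> count X x" using that by simp
        then have "replicate_mset 2 x \<subseteq># X" by (simp only: count_le_replicate_mset_subset_eq)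
        then obtain Y where "X = replicate_mset 2 x + Y" by (metis subset_mset.add_diff_inverse)
        then show ?thesis by (auto simp: numeral_2_eq_2)
      qed
      obtain t X where X: "T = add_mset t (add_mset t X)" using False twice by blast
      have "t \<noteq> 0" using nzT[OF TN(1)] X by auto
      then have "X \<noteq> {#}" using TN(2) X double_eq_0[of t] by auto
      show False
      proof (cases "\<forall>x. count X x \<le> 1")
        case True
        then show False
          using max_zero_sum_not_one_repetition[OF T _ nz X \<open>X \<noteq> {#}\<close> True[rule_format] lines4[OF \<open>t \<noteq> 0\<close>]] 8 by simp
      next
        case False
        then obtain s Y where "X = add_mset s (add_mset s Y)" using twice by blast
        then have Y: "T = add_mset t (add_mset t (add_mset s (add_mset s Y)))" using X by simp
        have "size Y \<le> 1" using True Y size(2) by simp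
        then consider "Y = {#}" | c where "Y = {#c#}"
          by (metis One_nat_def le_Suc_eq le_zero_eq size_1_singleton_mset size_eq_0_iff_empty)
        then show False
        proof cases
          case 1
          then have "(t + s) + (t + s) = 0" using TN(2) Y by (simp add: algebra_simps)
          then have ts: "t + s = 0" by (simp only: double_eq_0)
          then have "t \<noteq> s" using \<open>t \<noteq> 0\<close> double_eq_0[of t] by auto
          have "t \<in># N - T" "s \<in># N - T" using inR Y by simp_all
          then obtain B where B: "N - T = add_mset t B" by (meson multi_member_split)
          then have "s \<in># add_mset t B" using \<open>s \<in># N - T\<close> by (simp only:)
          then have "{#t, s#} \<subseteq># N - T" unfolding B using \<open>t \<noteq> s\<close> by simp
          from zero_sum_freeD[OF free this] ts show False by simp
        next
          case 2
          then have T5: "T = {#t, t, s, s, c#}" using Y by simp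
          then have "det2 t s = 0"
            using few[OF TN(1) \<open>T \<noteq> {#}\<close> TN(2)] areas_two_squares[of t s c] TN(2) size(2) by force
          moreover have "det2 t (sum_mset T) = 0" using TN(2) by simp
          then have "det2 t c = 0" using \<open>det2 t s = 0\<close> T5 by simp
          ultimately have "filter_mset (\<lambda>w. det2 t w = 0) T = T" using T5 by simp
          then have "size T \<le> size (filter_mset (\<lambda>w. det2 t w = 0) N)"
            using TN(1) multiset_filter_mono size_mset_mono by metis
          then show False using lines4[OF \<open>t \<noteq> 0\<close>] T5 by simp
        qed
      qed
    qed
  next
    case False
    then have long: "size N \<le> size T + 7" using ge by simp
    have flat: "\<not> spanning T" using short[OF TN] long by auto
    obtain v where v: "v \<in># T" using \<open>T \<noteq> {#}\<close> by blast
    then have "v \<noteq> 0" using nzT[OF TN(1)] by auto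
    let ?L = "filter_mset (\<lambda>w. det2 v w = 0) N" and ?M = "filter_mset (\<lambda>w. det2 v w \<noteq> 0) N"
    have par: "det2 v u = 0" if "u \<in># T" for u using that v flat by (auto simp: spanning_def)
    then have "filter_mset (\<lambda>w. det2 v w = 0) T = T" by (simp add: filter_mset_eq_conv)
    then have TL: "T \<subseteq># ?L" using TN(1) multiset_filter_mono by metis
    then have T34: "size T \<le> size ?L" "size ?L \<le> 4" "3 \<le> size T"
      using lines4[OF \<open>v \<noteq> 0\<close>] long size10 size_mset_mono by auto
    then have M58: "5 \<le> size ?M" "size ?M \<le> 8" using split[of v] long size10 by auto
    have M: "4 \<le> size ?M" "size ?M mod 5 \<noteq> 4"
      using M58(1) mod_5_neq_4[OF M58] by linarith+
    have cover: "\<exists>P. P \<subseteq># ?L \<and> P \<noteq> {#} \<and> sum_mset P = w \<and> size ?L \<le> size P + 4"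
      if w: "det2 v w = 0" for w
      using zero_sum_line_sum[OF \<open>v \<noteq> 0\<close> nzT[OF TN(1)] T34(3) TN(2) par w] TL T34(2)
      by (meson subset_mset.order_trans trans_le_add2)
    obtain T' where "T' \<subseteq># N" "sum_mset T' = 0" "spanning T'" "size N \<le> size T' + 7"
      using long_spanning_zero_sum[OF nz \<open>v \<noteq> 0\<close> M cover] by blast
    then show False using short[of T'] by simp
  qed
qed

section \<open>The Heisenberg group in exponential coordinates\<close>

text \<open>
  The exponential coordinates of the group: the constant 3 is \<open>1/2\<close> in the field. In these
  coordinates the multiplication is symmetric up to the term \<open>3 det2 u u'\<close>, and commuting
  elements simply add.
\<close>

definition heis_exp :: "(5 \<times> 5) \<times> 5 \<Rightarrow> 5 ^ 3 ^ 3" where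
  "heis_exp g = heis_mat (fst (fst g)) (snd (fst g)) (snd g + 3 * fst (fst g) * snd (fst g))"

lemma heis_exp_mult:
  "heis_exp (u, h) ** heis_exp (u', h') = heis_exp (u + u', h + h' + 3 * det2 u u')"
proof -
  have six: "6 * z = z" for z :: 5
  proof -
    have "\<forall>z::5. 6 * z = z" unfolding F5_all by simp
    then show ?thesis by blast
  qed
  have "3 * (fst u * snd u') + 3 * (fst u * snd u') = 6 * (fst u * snd u')"
    by (simp only: numeral_plus_numeral flip: distrib_right) simp
  then have "3 * (fst u * snd u') + 3 * (fst u * snd u') = fst u * snd u'" by (simp only: six)
  then show ?thesis
    unfolding heis_exp_def heis_mat_mult heis_mat_eq_iff det2_def
    by (simp add: algebra_simps del: distrib_right_numeral) 
qed

lemma heis_exp_eq_iff [simp]: "heis_exp g = heis_exp g' \<longleftrightarrow> g = g'"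
  by (auto simp: heis_exp_def heis_mat_eq_iff prod_eq_iff)

lemma one_H125: "\<one>\<^bsub>H125\<^esub> = heis_exp 0"
  by (simp add: H125_def mat_1_eq_heis_mat heis_exp_def)

lemma carrier_H125: "carrier H125 = range heis_exp"
proof -
  have "heis_mat a b c = heis_exp ((a, b), c - 3 * a * b)" for a b c
    by (simp add: heis_exp_def)
  then have "heis_mat a b c \<in> range heis_exp" for a b c by (metis rangeI)
  moreover have "heis_exp g \<in> carrier H125" for g by (auto simp: H125_def heis_exp_def)
  ultimately show ?thesis by (auto simp: H125_def)
qed

lemma foldr_mult_H125:
  "foldr (\<otimes>\<^bsub>H125\<^esub>) (map heis_exp gs) \<one>\<^bsub>H125\<^esub> =
    heis_exp (sum_list (map fst gs), sum_list (map snd gs) + 3 * area (map fst gs))"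
proof (induction gs)
  case Nil
  then show ?case by (simp add: one_H125 zero_prod_def)
next
  case (Cons g gs)
  then show ?case
    by (cases g) (simp add: H125_def heis_exp_mult algebra_simps)
qed

section \<open>Sequences of length 13\<close>

lemma ex_list_over_image:
  "mset us = image_mset f J \<Longrightarrow> \<exists>js. mset js = J \<and> map f js = us"
proof (induction us arbitrary: J)
  case (Cons u us)
  then obtain j J' where "J = add_mset j J'" "u = f j" "mset us = image_mset f J'"
    by (metis mset.simps(2) msed_map_invR)
  moreover from this obtain js where "mset js = J'" "map f js = us" using Cons.IH by blast
  ultimately show ?case by (intro exI[of _ "j # js"]) simp
qed simp

text \<open>
  The two equations say that the product of \<open>gs\<close> in exponential coordinates is 0, see
  \<open>foldr_mult_H125\<close>.
\<close>

definition has_product_one :: "((5 \<times> 5) \<times> 5) multiset \<Rightarrow> bool" where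
  "has_product_one S \<longleftrightarrow> (\<exists>gs. gs \<noteq> [] \<and> mset gs \<subseteq># S \<and> sum_list (map fst gs) = 0 \<and>
     sum_list (map snd gs) + 3 * area (map fst gs) = 0)"

lemma has_product_one_parallel:
  assumes J: "J \<subseteq># S" "J \<noteq> {#}" and par: "\<And>g. g \<in># J \<Longrightarrow> det2 v (fst g) = 0" and v: "v \<noteq> 0"
    and sum: "sum_mset (image_mset fst J) = 0" "sum_mset (image_mset snd J) = 0"
  shows "has_product_one S"
proof -
  obtain gs where gs: "mset gs = J" using ex_mset by blast
  have "area (map fst gs) = 0"
    using par gs det2_eq_0_trans[OF _ _ v] by (intro area_parallel) auto
  moreover have "sum_list (map fst gs) = 0" "sum_list (map snd gs) = 0"
    using sum gs by (metis mset_map sum_mset_sum_list)+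
  moreover have "gs \<noteq> []" using gs J(2) by auto
  ultimately show ?thesis unfolding has_product_one_def using gs J(1) by (intro exI[of _ gs]) simp
qed

text \<open>
  The elements over one line form a subgroup isomorphic to the plane, to which Olson's theorem
  applies.
\<close>

lemma has_product_one_line:
  assumes v: "v \<noteq> 0" and size: "9 \<le> size (filter_mset (\<lambda>g. det2 v (fst g) = 0) S)"
  shows "has_product_one S"
proof -
  let ?B = "filter_mset (\<lambda>g. det2 v (fst g) = 0) S"
  obtain v' where v': "det2 v' v \<noteq> 0" using ex_transversal[OF v] by blast
  \<comment> \<open>The coordinates of such an element: its position on the line and its central part.\<close>
  define f where "f g = (det2 v' (fst g), snd g)" for g :: "(5 \<times> 5) \<times> 5"
  have "\<not> zero_sum_free (image_mset f ?B)" using size by (intro not_zero_sum_free_F5_plane) simp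
  then obtain T where T: "T \<subseteq># image_mset f ?B" "T \<noteq> {#}" "sum_mset T = 0"
    unfolding zero_sum_free_def by blast
  obtain J where J: "J \<subseteq># ?B" "image_mset f J = T" using subseteq_image_mset[OF T(1)] by blast
  have par: "det2 v (fst g) = 0" if "g \<in># J" for g using that J(1) by (auto dest: mset_subset_eqD)
  have "sum_mset (image_mset f J) = (det2 v' (sum_mset (image_mset fst J)), sum_mset (image_mset snd J))" for J
    by (induction J) (auto simp: f_def prod_eq_iff)
  from this[of J] T(3) J(2)
  have "(det2 v' (sum_mset (image_mset fst J)), sum_mset (image_mset snd J)) = 0" by simp
  then have sums: "det2 v' (sum_mset (image_mset fst J)) = 0" "sum_mset (image_mset snd J) = 0"
    by (simp_all add: prod_eq_iff)
  have "det2 v (sum_mset (image_mset fst J)) = 0" using par by (intro det2_sum_mset_zero) auto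
  then have "sum_mset (image_mset fst J) = 0"
    using parallel_eq[OF v', of "sum_mset (image_mset fst J)" 0] sums(1) by simp
  moreover have "J \<subseteq># S" using J(1) by (meson multiset_filter_subset subset_mset.order_trans)
  moreover have "J \<noteq> {#}" using J(2) T(2) by auto
  ultimately show ?thesis using has_product_one_parallel[OF _ _ par v] sums(2) by blast
qed

text \<open>
  Split off the central elements \<open>C\<close> and let \<open>k\<close> be their number. Five of them have a product-one
  subsequence, as do nine elements over one line. Otherwise the projections of the \<open>13 - k\<close>
  other elements contain a zero-sum subsequence with at least \<open>5 - k\<close> areas. Its products are
  that many central elements, and multiplying by subsequences of \<open>C\<close> increases their number to
  5, so that the identity is among them.
\<close>

theorem has_product_one_if_size_13:
  assumes size: "size S = 13" and nz: "0 \<notin># S"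
  shows "has_product_one S"
proof -
  define C where "C = filter_mset (\<lambda>g. fst g = 0) S"
  define M where "M = filter_mset (\<lambda>g. fst g \<noteq> 0) S"
  define N where "N = image_mset fst M"
  define Z where "Z = image_mset snd C"
  have S: "S = C + M" by (simp add: C_def M_def)
  then have sizeN: "size N + size Z = 13" using size by (simp add: N_def Z_def)
  have C0: "fst g = 0" if "g \<in># C" for g using that by (simp add: C_def)
  have nzZ: "0 \<notin># Z"
    using nz by (force simp: Z_def C_def zero_prod_def)
  have nzN: "0 \<notin># N" by (auto simp: N_def M_def)
  have "size Z \<le> 4" if "\<not> 5 \<le> size Z" using that by simp
  then consider "5 \<le> size Z" | v where "v \<noteq> 0" "size N < size (filter_mset (\<lambda>w. det2 v w = 0) N) + 5"
    | "size Z \<le> 4" "\<And>v. v \<noteq> 0 \<Longrightarrow> size (filter_mset (\<lambda>w. det2 v w = 0) N) + 5 \<le> size N"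
    by (metis not_less)
  then show ?thesis
  proof cases
    case 1
    then obtain T where T: "T \<subseteq># Z" "T \<noteq> {#}" "sum_mset T = 0"
      using not_zero_sum_free_F5 unfolding zero_sum_free_def by blast
    obtain J where J: "J \<subseteq># C" "image_mset snd J = T"
      using subseteq_image_mset T(1) unfolding Z_def by blast
    have J0: "fst g = 0" if "g \<in># J" for g using C0[OF mset_subset_eqD[OF J(1) that]] .
    then have "image_mset fst J = image_mset (\<lambda>_. 0) J" by (intro image_mset_cong)
    then have "sum_mset (image_mset fst J) = 0" by simp
    moreover have "J \<subseteq># S" using J(1) unfolding S by (metis subset_mset.order_trans mset_subset_eq_add_left)
    moreover have "J \<noteq> {#}" using J T(2) by auto
    moreover have "det2 (1, 0) (fst g) = 0" if "g \<in># J" for g using J0[OF that] by simp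
    ultimately show ?thesis
      using has_product_one_parallel[of J S "(1, 0)"] J(2) T(3) by (simp add: prod_eq_iff)
  next
    case 2
    have "filter_mset (\<lambda>g. det2 v (fst g) = 0) C = C" using C0 by (simp add: filter_mset_eq_conv)
    moreover have "filter_mset (\<lambda>w. det2 v w = 0) N = image_mset fst (filter_mset (\<lambda>g. det2 v (fst g) = 0) M)"
      by (simp add: N_def filter_mset_image_mset)
    ultimately have "size (filter_mset (\<lambda>g. det2 v (fst g) = 0) S) = size Z + size (filter_mset (\<lambda>w. det2 v w = 0) N)"
      unfolding S by (simp add: Z_def)
    then show ?thesis using 2 sizeN by (intro has_product_one_line[of v]) auto
  next
    case 3
    then have "9 \<le> size N" "size N \<le> 13" using sizeN by auto
    from zero_sum_with_many_areas[OF nzN this 3(2)]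
    obtain T where T: "T \<subseteq># N" "T \<noteq> {#}" "sum_mset T = 0" "size N - 8 \<le> card (areas T)" by blast
    obtain J where J: "J \<subseteq># M" "image_mset fst J = T"
      using subseteq_image_mset T(1) unfolding N_def by blast
    define A where "A = (\<lambda>a. sum_mset (image_mset snd J) + 3 * a) ` areas T"
    have "inj_on (\<lambda>a. sum_mset (image_mset snd J) + 3 * a) (areas T)"
    proof (rule inj_onI)
      fix a b assume "sum_mset (image_mset snd J) + 3 * a = sum_mset (image_mset snd J) + 3 * b"
      then have "3 * (a - b) = 0" by (simp only: add_left_cancel right_diff_distrib diff_self)
      then have "(3::5) = 0 \<or> a - b = 0" by (simp only: F5_mult_eq_0)
      then show "a = b" by simp
    qed
    then have "card A = card (areas T)" by (simp add: A_def card_image)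
    moreover have "A \<noteq> {}" using areas_nonempty by (simp add: A_def)
    ultimately have "5 \<le> card {a + s | a s. a \<in> A \<and> s \<in> subsums Z}"
      using card_plus_subsums[OF _ nzZ, of A] T(4) sizeN by simp
    then have "0 \<in> {a + s | a s. a \<in> A \<and> s \<in> subsums Z}" using F5_set_eq_UNIV by blast
    then obtain us s where us: "mset us = T" "s \<in> subsums Z"
      "sum_mset (image_mset snd J) + 3 * area us + s = 0"
      by (auto simp: A_def areas_def)
    obtain js where js: "mset js = J" "map fst js = us" using ex_list_over_image us(1) J(2) by metis
    obtain R where "R \<subseteq># Z" "sum_mset R = s" using us(2) by (rule subsumsE)
    then obtain Q where Q: "Q \<subseteq># C" "sum_mset (image_mset snd Q) = s"
      using subseteq_image_mset unfolding Z_def by metis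
    obtain qs where qs: "mset qs = Q" using ex_mset by blast
    have q_map: "map fst qs = map (\<lambda>_. 0) qs"
      using qs C0[OF mset_subset_eqD[OF Q(1)]] by (intro map_cong) auto
    have "sum_list (map (\<lambda>_. 0) qs) = (0 :: 5 \<times> 5)" "area (map (\<lambda>_. 0) qs) = 0"
      by (induction qs) simp_all
    then have q0: "sum_list (map fst qs) = 0" "area (map fst qs) = 0"
      by (simp_all only: q_map)
    have "mset (js @ qs) \<subseteq># S"
      unfolding S mset_append js qs using subset_mset.add_mono[OF J(1) Q(1)] by (simp add: add.commute)
    moreover have "js \<noteq> []" using js us(1) T(2) by auto
    moreover have "sum_list (map fst (js @ qs)) = 0"
      using q0 T(3) us(1) js(2) sum_mset_sum_list[of us] by simp
    moreover have "sum_list (map snd js) = sum_mset (image_mset snd J)" "sum_list (map snd qs) = s"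
      using js(1) qs Q(2) by (metis mset_map sum_mset_sum_list)+
    then have "sum_list (map snd (js @ qs)) + 3 * area (map fst (js @ qs)) = 0"
      using us(3) q0 js(2) by (simp add: area_append algebra_simps)
    ultimately show ?thesis unfolding has_product_one_def by (intro exI[of _ "js @ qs"]) simp
  qed
qed

lemma product_one_free_size_le_12:
  assumes seq: "sequence_over H125 T" and free: "product_one_free H125 T"
  shows "size T \<le> 12"
proof (rule ccontr)
  assume "\<not> size T \<le> 12"
  then obtain A where A: "A \<subseteq># T" "size A = 13" using ex_subset_size[of 13 T] by auto
  have A_carrier: "g \<in> range heis_exp \<and> g \<noteq> heis_exp 0" if "g \<in># A" for g
    using seq that A(1) mset_subset_eqD unfolding sequence_over_def carrier_H125 one_H125 by fast
  define S where "S = image_mset (inv_into UNIV heis_exp) A"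
  have "image_mset heis_exp S = image_mset id A"
    unfolding S_def image_mset.compositionality
    by (intro image_mset_cong) (use A_carrier in \<open>auto simp: f_inv_into_f\<close>)
  then have S: "image_mset heis_exp S = A" by simp
  have "0 \<notin># S"
  proof
    assume "0 \<in># S"
    then have "heis_exp 0 \<in># image_mset heis_exp S" by simp
    then show False using A_carrier unfolding S by blast
  qed
  then have "has_product_one S" using has_product_one_if_size_13[of S] A(2) S by (metis size_image_mset)
  then obtain gs where gs: "gs \<noteq> []" "mset gs \<subseteq># S" "sum_list (map fst gs) = 0"
      "sum_list (map snd gs) + 3 * area (map fst gs) = 0"
    unfolding has_product_one_def by blast
  have "foldr (\<otimes>\<^bsub>H125\<^esub>) (map heis_exp gs) \<one>\<^bsub>H125\<^esub> = \<one>\<^bsub>H125\<^esub>"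
    using foldr_mult_H125[of gs] unfolding gs(3,4) zero_prod_def[symmetric] one_H125[symmetric] .
  moreover have "mset (map heis_exp gs) \<subseteq># T"
    using image_mset_subseteq_mono[OF gs(2), of heis_exp] S A(1) by (simp add: subset_mset.order_trans)
  ultimately show False
    using free gs(1) unfolding product_one_free_def by (metis mset_zero_iff list.map_disc_iff)
qed

section \<open>The sequence of length 12\<close>

text \<open>
  The superdiagonal entries of a product count the letters \<open>x\<close> and \<open>y\<close>. If no \<open>x\<close> occurs, then the
  corner entry counts the letters \<open>v\<close>.
\<close>

lemma foldr_mult_generators:
  assumes "set ms \<subseteq> {heis_mat 1 0 0, heis_mat 0 1 0, heis_mat 0 0 1}"
  shows "\<exists>c. foldr (\<otimes>\<^bsub>H125\<^esub>) ms \<one>\<^bsub>H125\<^esub> =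
      heis_mat (of_nat (count (mset ms) (heis_mat 1 0 0))) (of_nat (count (mset ms) (heis_mat 0 1 0))) c \<and>
    (heis_mat 1 0 0 \<notin> set ms \<longrightarrow> c = of_nat (count (mset ms) (heis_mat 0 0 1)))"
  using assms
proof (induction ms)
  case Nil
  then show ?case by (simp add: H125_def mat_1_eq_heis_mat heis_mat_eq_iff)
next
  case (Cons m ms)
  then show ?case by (auto simp: H125_def heis_mat_mult heis_mat_eq_iff algebra_simps)
qed

lemma F5_of_nat_eq_0: "n \<le> 4 \<Longrightarrow> of_nat n = (0::5) \<Longrightarrow> n = 0"
proof -
  assume "n \<le> 4" "of_nat n = (0::5)"
  moreover from this(1) have "n \<in> {0, 1, 2, 3, 4}" by auto
  ultimately show "n = 0" by auto
qed

lemma product_one_free_generators: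
  "product_one_free H125 (replicate_mset 4 (heis_mat 1 0 0) + replicate_mset 4 (heis_mat 0 1 0)
     + replicate_mset 4 (heis_mat 0 0 1))" (is "product_one_free _ ?S")
  unfolding product_one_free_def
proof (intro allI impI notI)
  fix T assume T: "T \<subseteq># ?S \<and> T \<noteq> {#}"
    and "\<exists>ms. mset ms = T \<and> foldr (\<otimes>\<^bsub>H125\<^esub>) ms \<one>\<^bsub>H125\<^esub> = \<one>\<^bsub>H125\<^esub>"
  then obtain ms where ms: "mset ms = T" "foldr (\<otimes>\<^bsub>H125\<^esub>) ms \<one>\<^bsub>H125\<^esub> = \<one>\<^bsub>H125\<^esub>" by blast
  have le: "count T (heis_mat 1 0 0) \<le> 4" "count T (heis_mat 0 1 0) \<le> 4" "count T (heis_mat 0 0 1) \<le> 4"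
    using mset_subset_eq_count[OF conjunct1[OF T], of "heis_mat 1 0 0"]
      mset_subset_eq_count[OF conjunct1[OF T], of "heis_mat 0 1 0"]
      mset_subset_eq_count[OF conjunct1[OF T], of "heis_mat 0 0 1"]
    by (simp_all add: heis_mat_eq_iff)
  have set: "set ms \<subseteq> {heis_mat 1 0 0, heis_mat 0 1 0, heis_mat 0 0 1}"
    using T ms(1) by (auto dest!: mset_subset_eqD split: if_splits)
  have one: "\<one>\<^bsub>H125\<^esub> = heis_mat 0 0 0" by (simp add: H125_def mat_1_eq_heis_mat)
  obtain c where "heis_mat 0 0 0 =
        heis_mat (of_nat (count T (heis_mat 1 0 0))) (of_nat (count T (heis_mat 0 1 0))) c"
      and c: "heis_mat 1 0 0 \<notin> set ms \<longrightarrow> c = of_nat (count T (heis_mat 0 0 1))"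
    using foldr_mult_generators[OF set] unfolding ms(2) unfolding one ms(1) by blast
  then have zero: "of_nat (count T (heis_mat 1 0 0)) = (0::5)" "of_nat (count T (heis_mat 0 1 0)) = (0::5)" "c = 0"
    unfolding heis_mat_eq_iff by simp_all
  then have counts: "count T (heis_mat 1 0 0) = 0" "count T (heis_mat 0 1 0) = 0"
    using F5_of_nat_eq_0 le by blast+
  then have "heis_mat 1 0 0 \<notin> set ms" using ms(1) by (metis not_in_iff set_mset_mset)
  then have "count T (heis_mat 0 0 1) = 0" using c zero(3) F5_of_nat_eq_0 le(3) by metis
  with counts have "set_mset T \<inter> {heis_mat 1 0 0, heis_mat 0 1 0, heis_mat 0 0 1} = {}"
    by (auto simp: not_in_iff)
  then have "set_mset T = {}" using set ms(1) by (metis inf.absorb1 set_mset_mset)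
  then have "T = {#}" by simp
  then show False using T by simp
qed

theorem theorem1:
  fixes x y v :: "5 ^ 3 ^ 3" and S :: "(5 ^ 3 ^ 3) multiset"
  defines "x \<equiv> heis_mat 1 0 0" and "y \<equiv> heis_mat 0 1 0" and "v \<equiv> heis_mat 0 0 1"
  defines "S \<equiv> replicate_mset 4 x + replicate_mset 4 y + replicate_mset 4 v"
  shows "small_davenport H125 = 12 \<and> size S = 12 \<and>
    is_arg_max size (\<lambda>T. sequence_over H125 T \<and> product_one_free H125 T) S"
proof -
  have size: "size S = 12" by (simp add: S_def)
  have free: "product_one_free H125 S"
    unfolding S_def x_def y_def v_def by (rule product_one_free_generators)
  have seq: "sequence_over H125 S"
    by (auto simp: sequence_over_def S_def x_def y_def v_def H125_def mat_1_eq_heis_mat heis_mat_eq_iff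
        split: if_splits)
  have "Max {size T | T. sequence_over H125 T \<and> product_one_free H125 T} = 12"
  proof (rule Max_eqI)
    show "finite {size T | T. sequence_over H125 T \<and> product_one_free H125 T}"
      by (rule finite_subset[of _ "{..12}"]) (auto simp: product_one_free_size_le_12)
  qed (use size free seq product_one_free_size_le_12 in auto)
  then have "small_davenport H125 = 12" by (simp add: small_davenport_def)
  moreover have "is_arg_max size (\<lambda>T. sequence_over H125 T \<and> product_one_free H125 T) S"
    unfolding is_arg_max_def using seq free size product_one_free_size_le_12 by fastforce
  ultimately show ?thesis using size by blast
qed

end
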